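(* Let a three-dimensional rotating black hole metric (as in the context) satisfy the vacuum Einstein equations $R_{\mu\nu}-\frac12g_{\mu\nu}R+\Lambda g_{\mu\nu}=0$ with $\Lambda=-1$. Then the pole-skipping data of a massless scalar at orders $n=1,2$ satisfy the algebraic relations $$4+E_1(k)^2-4E_1(k^2)=0,$$ $$4E_1(k)^2+8E_1(k^2)-E_2(k^2)-4=0,$$ $$\begin{aligned}&48E_1(k)^2E_1(k^2)-12E_1(k)^4E_1(k^2)+48E_1(k^2)^2+12E_1(k)^2E_1(k^2)^2+16E_1(k^2)^3-16E_1(k^2)E_2(k^2)\\&+4E_1(k)^2E_1(k^2)E_2(k^2)+4E_2(k^4)-8E_1(k)E_1(k^2)E_2(k^3)+E_1(k)^2E_2(k^4)+12E_1(k^2)E_2(k^4)=0,\end{aligned}$$ $$32E_1(k)E_1(k^2)+32E_1(k)^3E_1(k^2)-64E_1(k)E_1(k^2)^2-8E_1(k)E_1(k^2)E_2(k^2)+8E_1(k^2)E_2(k^3)=0.$$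
   Context: Metric: $ds^2=-\frac{f_1(z)}{z^2}dt^2+\frac{dz^2}{z^2f_2(z)}+\frac1{z^2}(d\varphi-f_3(z)dt)^2$, horizon at $z=1$, $f_a$ analytic near $z=1$, $f_1(1)=f_2(1)=0$, $f_3(1)=\Omega_H$, and $f_1'(1)f_2'(1)=(4\pi T)^2$ with $T>0$ the Hawking temperature. A massless scalar $\Phi=e^{-i\omega t+ik\varphi}\psi(z)$ satisfies $A\psi''+B\psi'+C\psi=0$ with $A=f_1f_2$, $B=\frac12(f_1f_2)'-\frac{f_1f_2}{z}$, $C=(\omega-kf_3)^2-k^2f_1$. Write $A_j,B_j,C_j$ for the coefficients of $(z-1)^j$ in $A,B,C$ (zero for $j<0$). Put $\mathfrak w=\omega-k\Omega_H$, $\rho=-i\mathfrak w/(4\pi T)$ and $$M_{KS}=A_{K-S+3}(\rho+S-1)(\rho+S-2)+B_{K-S+2}(\rho+S-1)+C_{K-S+1},$$ the coefficient of $\phi_{S-1}$ at order $(z-1)^{\rho+K}$ when $\psi=(z-1)^\rho\sum_j\phi_j(z-1)^j$ is inserted. At the pole-skipping frequency $\mathfrak w_n=-2\pi iTn$ (so $\rho=-n/2$, $\omega-kf_3=\mathfrak w_n-k(f_3-\Omega_H)$), $\det(M_{KS})_{1\le K,S\le n}$ is a polynomial in $k$ of degree $2n$; its roots (with multiplicity) are the order-$n$ pole-skipping momenta, and $E_n(k^l)$ denotes the elementary symmetric polynomial of degree $l$ in these $2n$ roots. *)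

theory Defs
  imports "HOL-Analysis.Analysis" "Jordan_Normal_Form.Determinant"
begin

no_notation Matrix.vec_index (infixl "$" 100)
hide_const (open) Matrix.vec Matrix.mat Matrix.row Matrix.col Determinant.det

section \<open>Curvature of a metric given in coordinates\<close>

definition coord_deriv :: "'n::finite \<Rightarrow> (real ^ 'n \<Rightarrow> real) \<Rightarrow> real ^ 'n \<Rightarrow> real" where
  "coord_deriv i F x = deriv (\<lambda>s. F (x + s *\<^sub>R axis i 1)) 0"

text \<open>\<open>christoffel g i j k\<close> is $\Gamma^i_{jk}$.\<close>

definition christoffel ::
  "(real ^ 'n \<Rightarrow> real ^ 'n ^ 'n) \<Rightarrow> 'n::finite \<Rightarrow> 'n \<Rightarrow> 'n \<Rightarrow> real ^ 'n \<Rightarrow> real" where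
  "christoffel g i j k x =
     (\<Sum>l\<in>UNIV. matrix_inv (g x) $ i $ l *
        (coord_deriv j (\<lambda>y. g y $ l $ k) x
         + coord_deriv k (\<lambda>y. g y $ l $ j) x
         - coord_deriv l (\<lambda>y. g y $ j $ k) x)) / 2"

text \<open>Sign convention: $R_{jk} = \partial_i\Gamma^i_{jk} - \partial_k\Gamma^i_{ji}
  + \Gamma^i_{il}\Gamma^l_{jk} - \Gamma^i_{kl}\Gamma^l_{ji}$, for which round spheres have
  positive curvature.\<close>

definition ricci ::
  "(real ^ 'n \<Rightarrow> real ^ 'n ^ 'n) \<Rightarrow> 'n::finite \<Rightarrow> 'n \<Rightarrow> real ^ 'n \<Rightarrow> real" where
  "ricci g j k x =
     (\<Sum>i\<in>UNIV. coord_deriv i (christoffel g i j k) x - coord_deriv k (christoffel g i j i) x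
        + (\<Sum>l\<in>UNIV. christoffel g i i l x * christoffel g l j k x
                   - christoffel g i k l x * christoffel g l j i x))"

definition scalar_curvature ::
  "(real ^ 'n \<Rightarrow> real ^ 'n ^ 'n) \<Rightarrow> real ^ 'n::finite \<Rightarrow> real" where
  "scalar_curvature g x = (\<Sum>j\<in>UNIV. \<Sum>k\<in>UNIV. matrix_inv (g x) $ j $ k * ricci g j k x)"

definition vacuum_einstein_at ::
  "(real ^ 'n \<Rightarrow> real ^ 'n ^ 'n) \<Rightarrow> real \<Rightarrow> real ^ 'n::finite \<Rightarrow> bool" where
  "vacuum_einstein_at g \<Lambda> x \<longleftrightarrow>
     (\<forall>\<mu> \<nu>. ricci g \<mu> \<nu> x - 1 / 2 * g x $ \<mu> $ \<nu> * scalar_curvature g x + \<Lambda> * g x $ \<mu> $ \<nu> = 0)"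


section \<open>The rotating metric\<close>

definition real_analytic_at :: "(real \<Rightarrow> real) \<Rightarrow> real \<Rightarrow> bool" where
  "real_analytic_at f x \<longleftrightarrow> (\<exists>F. (\<lambda>h. f (x + h)) has_fps_expansion F)"

text \<open>Coordinates are ordered $(t, z, \varphi)$; the square
  $(d\varphi - f_3\,dt)^2$ is expanded.\<close>

definition rotating_metric ::
  "(real \<Rightarrow> real) \<Rightarrow> (real \<Rightarrow> real) \<Rightarrow> (real \<Rightarrow> real) \<Rightarrow> real ^ 3 \<Rightarrow> real ^ 3 ^ 3" where
  "rotating_metric f1 f2 f3 x =
     (let z = x $ 2 in
      vector [vector [(f3 z ^ 2 - f1 z) / z ^ 2, 0, - f3 z / z ^ 2],
              vector [0, 1 / (z ^ 2 * f2 z), 0],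
              vector [- f3 z / z ^ 2, 0, 1 / z ^ 2]])"


section \<open>Pole-skipping data of a massless scalar\<close>

definition coeff_A :: "(real \<Rightarrow> real) \<Rightarrow> (real \<Rightarrow> real) \<Rightarrow> real \<Rightarrow> complex" where
  "coeff_A f1 f2 z = complex_of_real (f1 z * f2 z)"

definition coeff_B :: "(real \<Rightarrow> real) \<Rightarrow> (real \<Rightarrow> real) \<Rightarrow> real \<Rightarrow> complex" where
  "coeff_B f1 f2 z = complex_of_real (1 / 2 * deriv (\<lambda>y. f1 y * f2 y) z - f1 z * f2 z / z)"

definition coeff_C ::
  "(real \<Rightarrow> real) \<Rightarrow> (real \<Rightarrow> real) \<Rightarrow> complex \<Rightarrow> complex \<Rightarrow> real \<Rightarrow> complex" where
  "coeff_C f1 f3 \<omega> k z = (\<omega> - k * complex_of_real (f3 z)) ^ 2 - k ^ 2 * complex_of_real (f1 z)"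

text \<open>The coefficient of $(z-1)^j$; the index is an integer because the formula for $M_{KS}$
  also refers to negative powers.\<close>

definition taylor_coeff :: "(real \<Rightarrow> complex) \<Rightarrow> int \<Rightarrow> complex" where
  "taylor_coeff F j =
     (if j < 0 then 0
      else ((\<lambda>G z. vector_derivative G (at z)) ^^ nat j) F 1 / fact (nat j))"

definition horizon_exponent :: "real \<Rightarrow> complex \<Rightarrow> complex" where
  "horizon_exponent T \<ww> = - \<i> * \<ww> / complex_of_real (4 * pi * T)"

text \<open>The frequency argument of \<open>pole_skip_entry\<close> is the co-rotating one,
  $\mathfrak w = \omega - k\Omega_H$.\<close>

definition pole_skip_entry ::
  "(real \<Rightarrow> real) \<Rightarrow> (real \<Rightarrow> real) \<Rightarrow> (real \<Rightarrow> real) \<Rightarrow> real \<Rightarrow> real \<Rightarrow> complex \<Rightarrow> complex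
     \<Rightarrow> nat \<Rightarrow> nat \<Rightarrow> complex" where
  "pole_skip_entry f1 f2 f3 \<Omega> T \<ww> k K S =
     (let \<rho> = horizon_exponent T \<ww>;
          \<omega> = \<ww> + k * complex_of_real \<Omega>;
          s = of_nat S; d = int K - int S
      in taylor_coeff (coeff_A f1 f2) (d + 3) * (\<rho> + s - 1) * (\<rho> + s - 2)
         + taylor_coeff (coeff_B f1 f2) (d + 2) * (\<rho> + s - 1)
         + taylor_coeff (coeff_C f1 f3 \<omega> k) (d + 1))"

definition pole_skip_freq :: "real \<Rightarrow> nat \<Rightarrow> complex" where
  "pole_skip_freq T n = - 2 * complex_of_real pi * \<i> * complex_of_real T * of_nat n"

text \<open>Matrix indices are shifted because library matrices are indexed from 0.\<close>

definition pole_skip_det ::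
  "(real \<Rightarrow> real) \<Rightarrow> (real \<Rightarrow> real) \<Rightarrow> (real \<Rightarrow> real) \<Rightarrow> real \<Rightarrow> real \<Rightarrow> nat \<Rightarrow> complex \<Rightarrow> complex" where
  "pole_skip_det f1 f2 f3 \<Omega> T n k =
     Determinant.det (Matrix.mat n n
       (\<lambda>(i, j). pole_skip_entry f1 f2 f3 \<Omega> T (pole_skip_freq T n) k (i + 1) (j + 1)))"

definition pole_skip_poly ::
  "(real \<Rightarrow> real) \<Rightarrow> (real \<Rightarrow> real) \<Rightarrow> (real \<Rightarrow> real) \<Rightarrow> real \<Rightarrow> real \<Rightarrow> nat \<Rightarrow> complex poly" where
  "pole_skip_poly f1 f2 f3 \<Omega> T n = (THE p. \<forall>k. poly p k = pole_skip_det f1 f2 f3 \<Omega> T n k)"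

definition elem_sym_list :: "nat \<Rightarrow> 'a::comm_semiring_1 list \<Rightarrow> 'a" where
  "elem_sym_list l xs = (\<Sum>I | I \<subseteq> {..<length xs} \<and> card I = l. \<Prod>i\<in>I. xs ! i)"

text \<open>Elementary symmetric polynomial of a multiset: the value does not depend on the chosen
  enumeration, see \<open>elem_sym_mset\<close> below.\<close>

definition elem_sym :: "nat \<Rightarrow> 'a::comm_semiring_1 multiset \<Rightarrow> 'a" where
  "elem_sym l M = elem_sym_list l (SOME xs. mset xs = M)"

lemma elem_sym_list_cong_mset:
  assumes "mset xs = mset ys"
  shows "elem_sym_list l xs = elem_sym_list l ys"
proof -
  obtain p where p: "p permutes {..<length ys}" and xs: "permute_list p ys = xs"
    using assms by (rule mset_eq_permutation)
  have len: "length xs = length ys" using xs by auto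
  have inj: "inj p" using p by (rule permutes_inj)
  have "(\<Sum>I | I \<subseteq> {..<length ys} \<and> card I = l. \<Prod>i\<in>I. xs ! i)
      = (\<Sum>I | I \<subseteq> {..<length ys} \<and> card I = l. \<Prod>i\<in>I. ys ! i)"
  proof (rule sum.reindex_bij_witness[where i = "\<lambda>I. inv_into UNIV p ` I" and j = "\<lambda>I. p ` I"])
    fix I assume I: "I \<in> {I. I \<subseteq> {..<length ys} \<and> card I = l}"
    show "inv_into UNIV p ` p ` I = I" using inj by (simp add: image_comp)
    show "p ` I \<in> {I. I \<subseteq> {..<length ys} \<and> card I = l}"
    proof -
      have "p ` I \<subseteq> p ` {..<length ys}" using I by (intro image_mono) simp
      then have "p ` I \<subseteq> {..<length ys}" by (simp only: permutes_image[OF p])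
      then show ?thesis using I inj by (simp add: card_image inj_on_subset)
    qed
    have "(\<Prod>i\<in>p ` I. ys ! i) = (\<Prod>i\<in>I. ys ! p i)"
      using inj by (subst prod.reindex) (auto intro: inj_on_subset)
    also have "\<dots> = (\<Prod>i\<in>I. xs ! i)"
      using I p by (intro prod.cong) (auto simp: xs[symmetric] permute_list_nth)
    finally show "(\<Prod>i\<in>p ` I. ys ! i) = (\<Prod>i\<in>I. xs ! i)" .
  next
    fix I assume I: "I \<in> {I. I \<subseteq> {..<length ys} \<and> card I = l}"
    have q: "inv_into UNIV p permutes {..<length ys}" using p by (rule permutes_inv)
    show "p ` inv_into UNIV p ` I = I" using p by (simp add: image_comp permutes_inv_o)
    have "inv_into UNIV p ` I \<subseteq> inv_into UNIV p ` {..<length ys}" using I by (intro image_mono) simp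
    then have "inv_into UNIV p ` I \<subseteq> {..<length ys}" by (simp only: permutes_image[OF q])
    then show "inv_into UNIV p ` I \<in> {I. I \<subseteq> {..<length ys} \<and> card I = l}"
      using I permutes_inj[OF q] by (simp add: card_image inj_on_subset)
  qed
  then show ?thesis by (simp add: elem_sym_list_def len)
qed

lemma elem_sym_mset: "elem_sym l (mset xs) = elem_sym_list l xs"
  unfolding elem_sym_def by (rule elem_sym_list_cong_mset, rule someI[of _ xs]) simp

text \<open>\<open>pole_skip_E f1 f2 f3 \<Omega> T n l\<close> is $E_n(k^l)$.\<close>

definition pole_skip_E ::
  "(real \<Rightarrow> real) \<Rightarrow> (real \<Rightarrow> real) \<Rightarrow> (real \<Rightarrow> real) \<Rightarrow> real \<Rightarrow> real \<Rightarrow> nat \<Rightarrow> nat \<Rightarrow> complex" where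
  "pole_skip_E f1 f2 f3 \<Omega> T n l = elem_sym l (proots (pole_skip_poly f1 f2 f3 \<Omega> T n))"

end

(*
The Ricci tensor of the metric depends only on z, and the Einstein equations are equivalent to
Ric = -2 g.  Comparing the phi-phi equation with the Hamiltonian constraint, both of
first order, shows that f1/f2 is constant; the t-phi equation then gives z f3'' = f3'.
These are the equations of the rotating BTZ black hole.  Being analytic identities on a left
neighbourhood of the horizon, they hold for the Taylor series at z = 1, and their lowest orders
express the second jets at z = 1 through q = f2'(1), the ratio f1'(1)/f2'(1) and f3'(1), with one
further relation between these three.  The determinants for n = 1, 2 only involve these jets;
by Vieta all E_n(k^l) that occur are polynomials in s = E_1(k) and q with s^2 = -2q - 4, and the four
relations become identities in s.
*)
theory Submission
  imports Defs "HOL-Computational_Algebra.Fundamental_Theorem_Algebra"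
begin

section \<open>Power series expansions at a real point\<close>

text \<open>Dividing by \<open>fps_X ^ n\<close>, with \<open>n\<close> the subdegree, leaves a
  series with nonzero constant term. Its sum is continuous and stays nonzero near 0, so zeros of
  \<open>f\<close> cannot accumulate at 0.\<close>

lemma has_fps_expansion_eventually_nonzero:
  fixes f :: "'a::{banach, real_normed_field} \<Rightarrow> 'a"
  assumes "f has_fps_expansion F" "F \<noteq> 0"
  shows "\<forall>\<^sub>F x in at 0. f x \<noteq> 0"
proof -
  define n where "n = subdegree F"
  define G where "G = fps_shift n F"
  have "fps_conv_radius G > 0"
    using assms(1) by (simp add: G_def has_fps_expansion_def)
  then have "isCont (eval_fps G) 0"
    using has_fps_expansion_imp_continuous[OF eval_fps_has_fps_expansion] by blast
  moreover have "eval_fps G 0 \<noteq> 0"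
    using assms(2) by (simp add: G_def n_def eval_fps_at_0)
  ultimately have "\<forall>\<^sub>F x in at 0. eval_fps G x \<noteq> 0"
    unfolding isCont_def by (rule tendsto_imp_eventually_ne)
  moreover have "\<forall>\<^sub>F x in nhds 0. x \<in> eball 0 (fps_conv_radius F)"
    using assms(1) by (intro eventually_nhds_in_open) (auto simp: has_fps_expansion_def zero_ereal_def)
  then have "\<forall>\<^sub>F x in at 0. x \<in> eball 0 (fps_conv_radius F)"
    by (rule filter_leD[OF at_within_le_nhds])
  moreover have "\<forall>\<^sub>F x in at 0. eval_fps F x = f x"
    using assms(1) unfolding has_fps_expansion_def by (auto intro: filter_leD[OF at_within_le_nhds])
  moreover have "\<forall>\<^sub>F x in at (0::'a). x \<noteq> 0"
    by (simp add: eventually_at_filter)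
  ultimately show ?thesis
    by eventually_elim (auto simp: G_def n_def eval_fps_shift)
qed

text \<open>This carries identities known only on one side of the horizon over to Taylor series: the
  zeros of a nonzero series cannot fill a left neighbourhood of 0.\<close>

lemma has_fps_expansion_eq_0_at_left:
  fixes f :: "real \<Rightarrow> real"
  assumes "f has_fps_expansion F" "\<forall>\<^sub>F x in at_left 0. f x = 0"
  shows "F = 0"
proof (rule ccontr)
  assume "F \<noteq> 0"
  with assms(1) have "\<forall>\<^sub>F x in at 0. f x \<noteq> 0"
    by (rule has_fps_expansion_eventually_nonzero)
  then have "\<forall>\<^sub>F x in at_left 0. f x \<noteq> 0"
    by (rule filter_leD[OF at_le[OF subset_UNIV]])
  with assms(2) have "\<forall>\<^sub>F x in at_left (0::real). False"
    by eventually_elim simp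
  then show False
    by (simp add: eventually_False)
qed

lemma eventually_nhds_shift:
  "eventually P (nhds a) \<longleftrightarrow> (\<forall>\<^sub>F h in nhds 0. P (a + h))" for a :: "'a::real_normed_vector"
proof -
  have "filtermap (\<lambda>h. a + h) (nhds 0) = nhds a"
    using filtermap_nhds_shift[of "-a" 0] by (simp add: add.commute)
  then show ?thesis
    by (metis eventually_filtermap)
qed

lemma eventually_at_left_shift:
  "eventually P (at_left a) \<longleftrightarrow> (\<forall>\<^sub>F h in at_left 0. P (a + h))" for a :: real
  unfolding eventually_at_filter by (subst eventually_nhds_shift) simp

lemma deriv_shift_add: "deriv (\<lambda>h. f (a + h)) = (\<lambda>h. deriv f (a + h))"
  by (rule ext) (simp add: deriv_shift_0' o_def add_ac)

text \<open>The curvature computation needs genuine derivatives at all points near \<open>a\<close>,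
  not only at \<open>a\<close>. Termwise differentiation inside the disc of convergence supplies
  them.\<close>

lemma eventually_differentiable_of_fps_expansion:
  fixes f :: "real \<Rightarrow> real"
  assumes "(\<lambda>h. f (a + h)) has_fps_expansion F"
  shows "\<forall>\<^sub>F z in nhds a. (f has_field_derivative deriv f z) (at z)"
proof -
  have ev: "\<forall>\<^sub>F h in nhds 0. eval_fps F h = f (a + h)"
    using assms by (simp add: has_fps_expansion_def)
  have "\<forall>\<^sub>F h in nhds 0. h \<in> eball 0 (fps_conv_radius F)"
    using assms by (intro eventually_nhds_in_open) (auto simp: has_fps_expansion_def zero_ereal_def)
  \<comment> \<open>Agreement near 0 implies agreement near every \<open>h\<close> close to 0, so
    the derivative at \<open>a + h\<close> can be read off from the series.\<close>
  moreover have "\<forall>\<^sub>F h in nhds 0. \<forall>\<^sub>F k in nhds h. eval_fps F k = f (a + k)"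
    using ev by (simp add: eventually_eventually)
  ultimately have "\<forall>\<^sub>F h in nhds 0. (f has_field_derivative deriv f (a + h)) (at (a + h))"
  proof eventually_elim
    case (elim h)
    have "(eval_fps F has_field_derivative eval_fps (fps_deriv F) h) (at h)"
      using elim by (intro has_field_derivative_eval_fps) auto
    then have "((\<lambda>k. f (a + k)) has_field_derivative eval_fps (fps_deriv F) h) (at h)"
      using DERIV_cong_ev[OF refl elim(2) refl] by simp
    then have "(f has_field_derivative eval_fps (fps_deriv F) h) (at (a + h))"
      using DERIV_shift[of f _ h a] by (simp add: add.commute)
    then show ?case
      by (metis DERIV_imp_deriv)
  qed
  then show ?thesis
    by (simp add: eventually_nhds_shift[of _ a])
qed

section \<open>Expansions of complex-valued functions of a real variable\<close>

text \<open>Since \<open>has_fps_expansion\<close> concerns functions from a field to itself, a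
  complex function of a real variable is described as the restriction of a complex one to the real
  axis near \<open>a\<close>.\<close>

definition real_fps_expansion :: "(real \<Rightarrow> complex) \<Rightarrow> real \<Rightarrow> complex fps \<Rightarrow> bool" where
  "real_fps_expansion F a P \<longleftrightarrow>
     (\<exists>G. G has_fps_expansion P \<and> (\<forall>\<^sub>F h in nhds 0. F (a + h) = G (complex_of_real h)))"

lemma filterlim_of_real_nhds_0: "filterlim complex_of_real (nhds 0) (nhds 0)"
  using tendsto_of_real[OF filterlim_ident] by (metis of_real_0)

text \<open>The complex witness can be taken to be the sum of the series itself, because
  \<open>complex_of_real\<close> maps small reals to small complex numbers. This form suits
  differentiation.\<close>

lemma real_fps_expansion_eval:
  "real_fps_expansion F a P \<longleftrightarrow>
     fps_conv_radius P > 0 \<and> (\<forall>\<^sub>F h in nhds 0. F (a + h) = eval_fps P (complex_of_real h))"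
proof
  assume "real_fps_expansion F a P"
  then obtain G where G: "G has_fps_expansion P" "\<forall>\<^sub>F h in nhds 0. F (a + h) = G (complex_of_real h)"
    unfolding real_fps_expansion_def by blast
  have "\<forall>\<^sub>F h in nhds 0. eval_fps P (complex_of_real h) = G (complex_of_real h)"
    using G(1) filterlim_of_real_nhds_0 
    unfolding has_fps_expansion_def filterlim_iff by blast
  with G(2) have "\<forall>\<^sub>F h in nhds 0. F (a + h) = eval_fps P (complex_of_real h)"
    by eventually_elim simp
  with G(1) show "fps_conv_radius P > 0 \<and> (\<forall>\<^sub>F h in nhds 0. F (a + h) = eval_fps P (complex_of_real h))"
    by (simp add: has_fps_expansion_def)
next
  assume "fps_conv_radius P > 0 \<and> (\<forall>\<^sub>F h in nhds 0. F (a + h) = eval_fps P (complex_of_real h))"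
  then show "real_fps_expansion F a P"
    unfolding real_fps_expansion_def using eval_fps_has_fps_expansion by blast
qed

lemma real_fps_expansion_const: "real_fps_expansion (\<lambda>_. c) a (fps_const c)"
  unfolding real_fps_expansion_def by (rule exI[of _ "\<lambda>_. c"]) simp

lemma real_fps_expansion_add:
  assumes "real_fps_expansion F a P" "real_fps_expansion G a Q"
  shows "real_fps_expansion (\<lambda>z. F z + G z) a (P + Q)"
proof -
  obtain F' G' where *: "F' has_fps_expansion P" "G' has_fps_expansion Q"
    "\<forall>\<^sub>F h in nhds 0. F (a + h) = F' (complex_of_real h)" "\<forall>\<^sub>F h in nhds 0. G (a + h) = G' (complex_of_real h)"
    using assms unfolding real_fps_expansion_def by blast
  show ?thesis unfolding real_fps_expansion_def
    by (rule exI[of _ "\<lambda>w. F' w + G' w"], intro conjI has_fps_expansion_add *(1,2), use *(3,4) in eventually_elim) simp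
qed

lemma real_fps_expansion_mult:
  assumes "real_fps_expansion F a P" "real_fps_expansion G a Q"
  shows "real_fps_expansion (\<lambda>z. F z * G z) a (P * Q)"
proof -
  obtain F' G' where *: "F' has_fps_expansion P" "G' has_fps_expansion Q"
    "\<forall>\<^sub>F h in nhds 0. F (a + h) = F' (complex_of_real h)" "\<forall>\<^sub>F h in nhds 0. G (a + h) = G' (complex_of_real h)"
    using assms unfolding real_fps_expansion_def by blast
  show ?thesis unfolding real_fps_expansion_def
    by (rule exI[of _ "\<lambda>w. F' w * G' w"], intro conjI has_fps_expansion_mult *(1,2), use *(3,4) in eventually_elim) simp
qed

lemma real_fps_expansion_of_real:
  assumes "(\<lambda>h. f (a + h)) has_fps_expansion P"
  shows "real_fps_expansion (\<lambda>z. complex_of_real (f z)) a (Abs_fps (\<lambda>n. of_real (fps_nth P n)))"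
    (is "real_fps_expansion _ _ ?Q")
proof -
  \<comment> \<open>The radius of convergence depends only on the norms of the coefficients, which
    \<open>of_real\<close> preserves.\<close>
  have R: "fps_conv_radius ?Q = fps_conv_radius P"
  proof -
    have "fps_conv_radius (Abs_fps (\<lambda>n. norm (fps_nth ?Q n))) = fps_conv_radius (Abs_fps (\<lambda>n. norm (fps_nth P n)))"
      by simp
    then show ?thesis by (simp only: fps_conv_radius_norm)
  qed
  have "\<forall>\<^sub>F h in nhds 0. h \<in> eball 0 (fps_conv_radius P)"
    using assms by (intro eventually_nhds_in_open) (auto simp: has_fps_expansion_def zero_ereal_def)
  moreover have "\<forall>\<^sub>F h in nhds 0. eval_fps P h = f (a + h)"
    using assms by (simp add: has_fps_expansion_def)
  ultimately have "\<forall>\<^sub>F h in nhds 0. complex_of_real (f (a + h)) = eval_fps ?Q (complex_of_real h)"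
  proof eventually_elim
    case (elim h)
    then have "summable (\<lambda>n. fps_nth P n * h ^ n)"
      by (intro summable_fps) simp
    then have "complex_of_real (eval_fps P h) = eval_fps ?Q (complex_of_real h)"
      unfolding eval_fps_def by (subst suminf_of_real) simp_all
    with elim show ?case by simp
  qed
  with R assms show ?thesis
    unfolding real_fps_expansion_eval by (simp add: has_fps_expansion_def)
qed

text \<open>Along the real axis the derivative of a holomorphic function is its complex derivative,
  and the latter is computed termwise. Iteration evaluates the repeated
  \<open>vector_derivative\<close> in \<open>taylor_coeff\<close>.\<close>

lemma real_fps_expansion_vector_derivative:
  assumes "real_fps_expansion F a P"
  shows "real_fps_expansion (\<lambda>z. vector_derivative F (at z)) a (fps_deriv P)"
proof -
  have R: "fps_conv_radius P > 0" and ev: "\<forall>\<^sub>F h in nhds 0. F (a + h) = eval_fps P (complex_of_real h)"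
    using assms by (simp_all add: real_fps_expansion_eval)
  have "\<forall>\<^sub>F h in nhds 0. h \<in> eball 0 (fps_conv_radius P)"
    using R by (intro eventually_nhds_in_open) (auto simp: zero_ereal_def)
  moreover have "\<forall>\<^sub>F h in nhds 0. \<forall>\<^sub>F k in nhds h. F (a + k) = eval_fps P (complex_of_real k)"
    using ev by (simp add: eventually_eventually)
  ultimately have "\<forall>\<^sub>F h in nhds 0. vector_derivative F (at (a + h)) = eval_fps (fps_deriv P) (complex_of_real h)"
  proof eventually_elim
    case (elim h)
    have "(eval_fps P has_field_derivative eval_fps (fps_deriv P) (complex_of_real h)) (at (complex_of_real h))"
      using elim by (intro has_field_derivative_eval_fps) auto
    then have "((\<lambda>k. eval_fps P (complex_of_real k)) has_vector_derivative
        eval_fps (fps_deriv P) (complex_of_real h)) (at h)"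
      by (rule has_vector_derivative_real_field)
    then have d: "((\<lambda>k. eval_fps P (complex_of_real k)) has_vector_derivative
        eval_fps (fps_deriv P) (complex_of_real h)) (at (- a + (a + h)))"
      by simp
    have "((\<lambda>z. eval_fps P (complex_of_real (- a + z))) has_vector_derivative
        eval_fps (fps_deriv P) (complex_of_real h)) (at (a + h))"
    proof -
      have "((\<lambda>z. - a + z) has_vector_derivative 1) (at (a + h))"
        by (auto intro!: derivative_eq_intros)
      from vector_diff_chain_at[OF this d] show ?thesis
        by (simp add: o_def)
    qed
    moreover have "\<forall>\<^sub>F z in nhds (a + h). eval_fps P (complex_of_real (- a + z)) = F z"
      using elim(2) by (simp add: eventually_nhds_shift[of _ h] eventually_nhds_shift[of _ "a + h"] add.assoc eq_commute)
    ultimately have "(F has_vector_derivative eval_fps (fps_deriv P) (complex_of_real h)) (at (a + h))"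
      using has_vector_derivative_cong_ev[where x = "a + h" and S = UNIV and g = F]
        eventually_nhds_x_imp_x[where x = "a + h"] by (smt (verit) eventually_mono)
    then show ?case
      by (rule vector_derivative_at)
  qed
  moreover have "fps_conv_radius (fps_deriv P) > 0"
    using R fps_conv_radius_deriv[of P] by (auto intro: less_le_trans)
  ultimately show ?thesis
    by (simp add: real_fps_expansion_eval)
qed

lemma taylor_coeff_eq_fps_nth:
  assumes "real_fps_expansion F 1 P"
  shows "taylor_coeff F (int n) = fps_nth P n"
proof -
  have "real_fps_expansion (((\<lambda>G z. vector_derivative G (at z)) ^^ n) F) 1 ((fps_deriv ^^ n) P)"
    by (induction n) (simp_all add: assms real_fps_expansion_vector_derivative)
  then have "((\<lambda>G z. vector_derivative G (at z)) ^^ n) F (1 + 0) = eval_fps ((fps_deriv ^^ n) P) (complex_of_real 0)"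
    unfolding real_fps_expansion_eval using eventually_nhds_x_imp_x by blast
  then show ?thesis
    by (simp add: taylor_coeff_def eval_fps_at_0 fps_0th_higher_deriv)
qed

definition complex_fps :: "real fps \<Rightarrow> complex fps" where
  "complex_fps F = Abs_fps (\<lambda>n. of_real (fps_nth F n))"

lemma complex_fps_nth [simp]: "fps_nth (complex_fps F) n = of_real (fps_nth F n)"
  by (simp add: complex_fps_def)

lemma taylor_coeff_of_real:
  assumes "(\<lambda>h. f (1 + h)) has_fps_expansion F"
  shows "taylor_coeff (\<lambda>z. complex_of_real (f z)) (int n) = of_real (fps_nth F n)"
  using taylor_coeff_eq_fps_nth[OF real_fps_expansion_of_real[OF assms]] by simp

lemma has_fps_expansion_deriv_shift:
  fixes f :: "'a::{banach, real_normed_field} \<Rightarrow> 'a"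
  assumes "(\<lambda>h. f (a + h)) has_fps_expansion F"
  shows "(\<lambda>h. deriv f (a + h)) has_fps_expansion fps_deriv F"
  using has_fps_expansion_deriv[OF assms] by (simp add: deriv_shift_add)

lemma has_fps_expansion_nth_0:
  assumes "f has_fps_expansion F"
  shows "fps_nth F 0 = f 0"
proof -
  have "\<forall>\<^sub>F z in nhds 0. eval_fps F z = f z"
    using assms by (simp add: has_fps_expansion_def)
  then show ?thesis
    by (metis (mono_tags) eval_fps_at_0 eventually_nhds_x_imp_x)
qed

section \<open>Curvature of metrics depending on one coordinate\<close>

text \<open>\<open>matrix_inv\<close> is defined by choice, so an explicit inverse is identified
  through the uniqueness of two-sided inverses.\<close>

lemma matrix_inv_eqI:
  fixes A B :: "real ^ 'n ^ 'n"
  assumes "A ** B = Finite_Cartesian_Product.mat 1" "B ** A = Finite_Cartesian_Product.mat 1"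
  shows "matrix_inv A = B"
proof -
  have inv: "A ** matrix_inv A = Finite_Cartesian_Product.mat 1 \<and> matrix_inv A ** A = Finite_Cartesian_Product.mat 1"
    unfolding matrix_inv_def by (rule someI[of _ B]) (use assms in simp)
  have "matrix_inv A = (B ** A) ** matrix_inv A"
    by (simp add: assms(2) matrix_mul_lid)
  also have "\<dots> = B ** (A ** matrix_inv A)"
    by (simp add: matrix_mul_assoc)
  finally show ?thesis
    by (simp add: inv matrix_mul_rid)
qed

lemma coord_deriv_radial:
  fixes F :: "real \<Rightarrow> real" and x :: "real ^ 'n::finite"
  shows "coord_deriv i (\<lambda>y. F (y $ m)) x = (if i = m then deriv F (x $ m) else 0)"
proof (cases "i = m")
  case True
  then show ?thesis
    by (simp add: coord_deriv_def deriv_shift_0'[of "x $ m"] o_def axis_def)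
next
  case False
  then show ?thesis
    by (simp add: coord_deriv_def axis_def)
qed

text \<open>For a metric depending on coordinate \<open>m\<close> alone, the Christoffel symbols
  become functions of one real variable, so that the Ricci tensor only contains ordinary derivatives
  of them.\<close>

definition radial_christoffel :: "(real \<Rightarrow> real ^ 'n ^ 'n) \<Rightarrow> 'n \<Rightarrow> 'n::finite \<Rightarrow> 'n \<Rightarrow> 'n \<Rightarrow> real \<Rightarrow> real" where
  "radial_christoffel M m i j k z =
     (\<Sum>l\<in>UNIV. matrix_inv (M z) $ i $ l *
        ((if j = m then deriv (\<lambda>y. M y $ l $ k) z else 0)
         + (if k = m then deriv (\<lambda>y. M y $ l $ j) z else 0)
         - (if l = m then deriv (\<lambda>y. M y $ j $ k) z else 0))) / 2"

lemma christoffel_radial: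
  "christoffel (\<lambda>x. M (x $ m)) i j k = (\<lambda>x. radial_christoffel M m i j k (x $ m))"
proof
  fix x
  have *: "coord_deriv i (\<lambda>y. M (y $ m) $ a $ b) x = (if i = m then deriv (\<lambda>z. M z $ a $ b) (x $ m) else 0)" for i a b
    by (rule coord_deriv_radial)
  show "christoffel (\<lambda>x. M (x $ m)) i j k x = radial_christoffel M m i j k (x $ m)"
    unfolding christoffel_def radial_christoffel_def * ..
qed

lemma ricci_radial:
  "ricci (\<lambda>x. M (x $ m)) j k x =
     (\<Sum>i\<in>UNIV. (if i = m then deriv (radial_christoffel M m i j k) (x $ m) else 0)
        - (if k = m then deriv (radial_christoffel M m i j i) (x $ m) else 0)
        + (\<Sum>l\<in>UNIV. radial_christoffel M m i i l (x $ m) * radial_christoffel M m l j k (x $ m)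
                   - radial_christoffel M m i k l (x $ m) * radial_christoffel M m l j i (x $ m)))"
proof -
  have *: "coord_deriv i (\<lambda>x. radial_christoffel M m a b c (x $ m)) x
      = (if i = m then deriv (radial_christoffel M m a b c) (x $ m) else 0)" for i a b c
    by (rule coord_deriv_radial)
  show ?thesis
    unfolding ricci_def christoffel_radial[of M m] * ..
qed

text \<open>Contraction with the inverse metric in dimension 3 gives
  \<open>S = 3 * (S / 2 - \<Lambda>)\<close> for the scalar curvature, hence
  \<open>S = 6 * \<Lambda>\<close>, which eliminates the trace term.\<close>

lemma vacuum_einstein_imp_ricci:
  fixes g :: "real ^ 3 \<Rightarrow> real ^ 3 ^ 3"
  assumes "vacuum_einstein_at g \<Lambda> x" and "matrix_inv (g x) ** g x = Finite_Cartesian_Product.mat 1"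
    and sym: "\<And>\<mu> \<nu>. g x $ \<mu> $ \<nu> = g x $ \<nu> $ \<mu>"
  shows "ricci g \<mu> \<nu> x = 2 * \<Lambda> * g x $ \<mu> $ \<nu>"
proof -
  define S where "S = scalar_curvature g x"
  have R: "ricci g \<mu> \<nu> x = (S / 2 - \<Lambda>) * g x $ \<mu> $ \<nu>" for \<mu> \<nu>
  proof -
    have "ricci g \<mu> \<nu> x - 1 / 2 * g x $ \<mu> $ \<nu> * S + \<Lambda> * g x $ \<mu> $ \<nu> = 0"
      using assms(1) by (simp add: vacuum_einstein_at_def S_def)
    then show ?thesis by argo
  qed
  have "S = (\<Sum>j\<in>UNIV. \<Sum>k\<in>UNIV. matrix_inv (g x) $ j $ k * ((S / 2 - \<Lambda>) * g x $ k $ j))"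
    by (subst S_def) (simp add: scalar_curvature_def R sym)
  also have "\<dots> = (S / 2 - \<Lambda>) * (\<Sum>j\<in>UNIV. \<Sum>k\<in>UNIV. matrix_inv (g x) $ j $ k * g x $ k $ j)"
    by (simp only: sum_distrib_left mult.left_commute)
  also have "(\<Sum>j\<in>UNIV. \<Sum>k\<in>UNIV. matrix_inv (g x) $ j $ k * g x $ k $ j)
      = (\<Sum>j\<in>UNIV. (matrix_inv (g x) ** g x) $ j $ j)"
    by (simp add: matrix_matrix_mult_def)
  also have "\<dots> = 3"
    unfolding assms(2) by (simp add: Finite_Cartesian_Product.mat_def)
  finally have "S = 6 * \<Lambda>" by simp
  then show ?thesis using R by simp
qed

section \<open>Field equations of the rotating metric away from the horizon\<close>

context
  fixes f h w f' h' w' f'' w'' :: "real \<Rightarrow> real" and U :: "real set"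
  assumes U: "open U"
    and nz: "z \<in> U \<Longrightarrow> z \<noteq> 0" "z \<in> U \<Longrightarrow> f z \<noteq> 0" "z \<in> U \<Longrightarrow> h z \<noteq> 0"
    and df [derivative_intros]: "z \<in> U \<Longrightarrow> (f has_field_derivative f' z) (at z)"
    and dh [derivative_intros]: "z \<in> U \<Longrightarrow> (h has_field_derivative h' z) (at z)"
    and dw [derivative_intros]: "z \<in> U \<Longrightarrow> (w has_field_derivative w' z) (at z)"
    and df' [derivative_intros]: "z \<in> U \<Longrightarrow> (f' has_field_derivative f'' z) (at z)"
    and dw' [derivative_intros]: "z \<in> U \<Longrightarrow> (w' has_field_derivative w'' z) (at z)"
begin

text \<open>\<open>f\<close>, \<open>h\<close>, \<open>w\<close> play the roles of
  \<open>f1\<close>, \<open>f2\<close>, \<open>f3\<close>, and the metric is regarded as a function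
  of the radial coordinate alone.\<close>

definition metric_profile :: "real \<Rightarrow> real ^ 3 ^ 3" where
  "metric_profile z = vector [vector [(w z ^ 2 - f z) / z ^ 2, 0, - w z / z ^ 2],
              vector [0, 1 / (z ^ 2 * h z), 0],
              vector [- w z / z ^ 2, 0, 1 / z ^ 2]]"

lemma rotating_metric_eq: "rotating_metric f h w = (\<lambda>x. metric_profile (x $ 2))"
  by (rule ext) (simp add: rotating_metric_def metric_profile_def Let_def)

text \<open>The t-phi block of the metric has determinant \<open>- f z / z ^ 4\<close> and is
  inverted separately from the z entry.\<close>

definition inverse_profile :: "real \<Rightarrow> real ^ 3 ^ 3" where
  "inverse_profile z = vector [vector [- (z ^ 2 / f z), 0, - w z * z ^ 2 / f z],
              vector [0, z ^ 2 * h z, 0],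
              vector [- w z * z ^ 2 / f z, 0, z ^ 2 * (f z - w z ^ 2) / f z]]"

lemma inverse_profile:
  assumes "z \<in> U"
  shows "metric_profile z ** inverse_profile z = Finite_Cartesian_Product.mat 1"
    and "inverse_profile z ** metric_profile z = Finite_Cartesian_Product.mat 1"
  unfolding Finite_Cartesian_Product.vec_eq_iff forall_3 matrix_matrix_mult_def Finite_Cartesian_Product.mat_def vec_lambda_beta
    sum_3 metric_profile_def inverse_profile_def vector_3
  using nz[OF assms] by (simp_all add: field_simps power2_eq_square)

lemma matrix_inv_profile: "z \<in> U \<Longrightarrow> matrix_inv (metric_profile z) = inverse_profile z"
  by (intro matrix_inv_eqI inverse_profile)

lemma deriv_profile:
  assumes "z \<in> U"
  shows "deriv (\<lambda>y. metric_profile y $ 1 $ 1) z = (2 * w z * w' z - f' z) / z ^ 2 - 2 * (w z ^ 2 - f z) / z ^ 3"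
    and "deriv (\<lambda>y. metric_profile y $ 1 $ 3) z = - w' z / z ^ 2 + 2 * w z / z ^ 3"
    and "deriv (\<lambda>y. metric_profile y $ 3 $ 1) z = - w' z / z ^ 2 + 2 * w z / z ^ 3"
    and "deriv (\<lambda>y. metric_profile y $ 3 $ 3) z = - 2 / z ^ 3"
    and "deriv (\<lambda>y. metric_profile y $ 2 $ 2) z = - 2 / (z ^ 3 * h z) - h' z / (z ^ 2 * h z ^ 2)"
    and "deriv (\<lambda>y. metric_profile y $ 1 $ 2) z = 0"
    and "deriv (\<lambda>y. metric_profile y $ 2 $ 1) z = 0"
    and "deriv (\<lambda>y. metric_profile y $ 2 $ 3) z = 0"
    and "deriv (\<lambda>y. metric_profile y $ 3 $ 2) z = 0"
proof -
  note nz' = nz[OF assms]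
  have "z ^ 2 \<noteq> 0" "z ^ 2 * h z \<noteq> 0" using nz' by auto
  note D = this df[OF assms] dh[OF assms] dw[OF assms]
  show "deriv (\<lambda>y. metric_profile y $ 1 $ 1) z = (2 * w z * w' z - f' z) / z ^ 2 - 2 * (w z ^ 2 - f z) / z ^ 3"
    unfolding metric_profile_def vector_3
    by (rule DERIV_imp_deriv, (rule derivative_eq_intros D refl)+)
      (use nz' in \<open>simp_all add: field_simps power2_eq_square power3_eq_cube\<close>)
  have "((\<lambda>y. - w y / y ^ 2) has_field_derivative - w' z / z ^ 2 + 2 * w z / z ^ 3) (at z)"
    by (rule derivative_eq_intros D refl)+
      (use nz' in \<open>simp_all add: field_simps power2_eq_square power3_eq_cube\<close>)
  then show "deriv (\<lambda>y. metric_profile y $ 1 $ 3) z = - w' z / z ^ 2 + 2 * w z / z ^ 3"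
    and "deriv (\<lambda>y. metric_profile y $ 3 $ 1) z = - w' z / z ^ 2 + 2 * w z / z ^ 3"
    unfolding metric_profile_def vector_3 by (rule DERIV_imp_deriv)+
  show "deriv (\<lambda>y. metric_profile y $ 3 $ 3) z = - 2 / z ^ 3"
    unfolding metric_profile_def vector_3
    by (rule DERIV_imp_deriv, (rule derivative_eq_intros D refl)+)
      (use nz' in \<open>simp_all add: field_simps power2_eq_square power3_eq_cube\<close>)
  show "deriv (\<lambda>y. metric_profile y $ 2 $ 2) z = - 2 / (z ^ 3 * h z) - h' z / (z ^ 2 * h z ^ 2)"
    unfolding metric_profile_def vector_3
    by (rule DERIV_imp_deriv, (rule derivative_eq_intros D refl)+)
      (use nz' in \<open>simp_all add: field_simps power2_eq_square power3_eq_cube\<close>)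
qed (simp_all add: metric_profile_def)

abbreviation "\<Gamma> \<equiv> radial_christoffel metric_profile 2"

text \<open>A symbol vanishes when the index 2 occurs in it an even number of times: the metric has
  no mixed z components, and only z derivatives survive.\<close>

lemma christoffel_profile:
  assumes "z \<in> U"
  shows "\<Gamma> 2 1 1 z = - h z / 2 * (2 * w z * w' z - f' z - 2 * (w z ^ 2 - f z) / z)"
    and "\<Gamma> 2 1 3 z = h z * w' z / 2 - h z * w z / z"
    and "\<Gamma> 2 3 1 z = h z * w' z / 2 - h z * w z / z"
    and "\<Gamma> 2 3 3 z = h z / z"
    and "\<Gamma> 2 2 2 z = - 1 / z - h' z / (2 * h z)"
    and "\<Gamma> 1 1 2 z = f' z / (2 * f z) - 1 / z - w z * w' z / (2 * f z)"
    and "\<Gamma> 1 2 1 z = f' z / (2 * f z) - 1 / z - w z * w' z / (2 * f z)"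
    and "\<Gamma> 1 3 2 z = w' z / (2 * f z)"
    and "\<Gamma> 1 2 3 z = w' z / (2 * f z)"
    and "\<Gamma> 3 1 2 z = (w z * f' z - f z * w' z - w z ^ 2 * w' z) / (2 * f z)"
    and "\<Gamma> 3 2 1 z = (w z * f' z - f z * w' z - w z ^ 2 * w' z) / (2 * f z)"
    and "\<Gamma> 3 3 2 z = - 1 / z + w z * w' z / (2 * f z)"
    and "\<Gamma> 3 2 3 z = - 1 / z + w z * w' z / (2 * f z)"
    and "\<Gamma> 1 1 1 z = 0" "\<Gamma> 1 1 3 z = 0" "\<Gamma> 1 3 1 z = 0" "\<Gamma> 1 3 3 z = 0" "\<Gamma> 1 2 2 z = 0"
    and "\<Gamma> 3 1 1 z = 0" "\<Gamma> 3 1 3 z = 0" "\<Gamma> 3 3 1 z = 0" "\<Gamma> 3 3 3 z = 0" "\<Gamma> 3 2 2 z = 0"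
    and "\<Gamma> 2 1 2 z = 0" "\<Gamma> 2 2 1 z = 0" "\<Gamma> 2 3 2 z = 0" "\<Gamma> 2 2 3 z = 0"
  using nz[OF assms]
  by (simp_all add: radial_christoffel_def sum_3 matrix_inv_profile[OF assms] deriv_profile[OF assms])
    (simp_all add: inverse_profile_def field_simps power2_eq_square power3_eq_cube)

text \<open>These derivatives suffice for the tt, t-phi, phi-phi and zz components of the Ricci
  tensor. In the zz component the derivative of \<open>\<Gamma> 2 2 2\<close> cancels, so no second
  derivative of \<open>h\<close> occurs.\<close>

lemma deriv_christoffel_profile:
  assumes "z \<in> U"
  shows "deriv (\<Gamma> 2 1 1) z = - h' z / 2 * (2 * w z * w' z - f' z - 2 * (w z ^ 2 - f z) / z)
      - h z / 2 * (2 * w' z ^ 2 + 2 * w z * w'' z - f'' z - 2 * (2 * w z * w' z - f' z) / z + 2 * (w z ^ 2 - f z) / z ^ 2)"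
    and "deriv (\<Gamma> 2 1 3) z = h' z * w' z / 2 + h z * w'' z / 2 - h' z * w z / z - h z * w' z / z + h z * w z / z ^ 2"
    and "deriv (\<Gamma> 2 3 3) z = h' z / z - h z / z ^ 2"
    and "deriv (\<Gamma> 1 2 1) z = f'' z / (2 * f z) - f' z ^ 2 / (2 * f z ^ 2) + 1 / z ^ 2
      - (w' z ^ 2 + w z * w'' z) / (2 * f z) + w z * w' z * f' z / (2 * f z ^ 2)"
    and "deriv (\<Gamma> 3 2 3) z = 1 / z ^ 2 + (w' z ^ 2 + w z * w'' z) / (2 * f z) - w z * w' z * f' z / (2 * f z ^ 2)"
proof -
  have U': "\<forall>\<^sub>F y in nhds z. y \<in> U"
    using U assms by (rule eventually_nhds_in_open)
  note nz' = nz[OF assms]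
  \<comment> \<open>The closed forms of the symbols hold only on \<open>U\<close>. Since
    \<open>U\<close> is open they hold near \<open>z\<close>, which is enough to differentiate
    them.\<close>
  have cong: "deriv G z = D" if "(G' has_field_derivative D) (at z)" "\<And>y. y \<in> U \<Longrightarrow> G y = G' y" for G G' D
  proof -
    have "deriv G z = deriv G' z"
      using U' by (intro deriv_cong_ev refl) (auto elim: eventually_mono simp: that(2))
    with that(1) show ?thesis by (simp add: DERIV_imp_deriv)
  qed
  show "deriv (\<Gamma> 2 1 1) z = - h' z / 2 * (2 * w z * w' z - f' z - 2 * (w z ^ 2 - f z) / z)
      - h z / 2 * (2 * w' z ^ 2 + 2 * w z * w'' z - f'' z - 2 * (2 * w z * w' z - f' z) / z + 2 * (w z ^ 2 - f z) / z ^ 2)"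
    by (rule cong[OF _ christoffel_profile(1)])
      (use nz' assms in \<open>auto intro!: derivative_eq_intros simp: field_simps power2_eq_square\<close>)
  show "deriv (\<Gamma> 2 1 3) z = h' z * w' z / 2 + h z * w'' z / 2 - h' z * w z / z - h z * w' z / z + h z * w z / z ^ 2"
    by (rule cong[OF _ christoffel_profile(2)])
      (use nz' assms in \<open>auto intro!: derivative_eq_intros simp: field_simps power2_eq_square\<close>)
  show "deriv (\<Gamma> 2 3 3) z = h' z / z - h z / z ^ 2"
    by (rule cong[OF _ christoffel_profile(4)])
      (use nz' assms in \<open>auto intro!: derivative_eq_intros simp: field_simps power2_eq_square\<close>)
  show "deriv (\<Gamma> 1 2 1) z = f'' z / (2 * f z) - f' z ^ 2 / (2 * f z ^ 2) + 1 / z ^ 2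
      - (w' z ^ 2 + w z * w'' z) / (2 * f z) + w z * w' z * f' z / (2 * f z ^ 2)"
    by (rule cong[OF _ christoffel_profile(7)])
      (use nz' assms in \<open>auto intro!: derivative_eq_intros simp: field_simps power2_eq_square\<close>)
  show "deriv (\<Gamma> 3 2 3) z = 1 / z ^ 2 + (w' z ^ 2 + w z * w'' z) / (2 * f z) - w z * w' z * f' z / (2 * f z ^ 2)"
    by (rule cong[OF _ christoffel_profile(13)])
      (use nz' assms in \<open>auto intro!: derivative_eq_intros simp: field_simps power2_eq_square\<close>)
qed

text \<open>The conclusions are the Hamiltonian constraint, its difference with the phi-phi
  equation, and the t-phi equation simplified by the second. They are cleared of denominators so
  that they also make sense as power series identities at the horizon, where \<open>f1\<close> and
  \<open>f2\<close> vanish.\<close>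

lemma vacuum_einstein_odes:
  assumes "z \<in> U" and "x $ 2 = z" and "vacuum_einstein_at (rotating_metric f h w) (-1) x"
  shows "2 * z * h z * f' z = 4 * h z * f z - 4 * f z + z ^ 2 * h z * w' z ^ 2"
    and "f' z * h z = f z * h' z"
    and "z * w'' z = w' z"
proof -
  note nz' = nz[OF assms(1)]
  have sym: "metric_profile z $ \<mu> $ \<nu> = metric_profile z $ \<nu> $ \<mu>" for \<mu> \<nu>
  proof -
    have "\<forall>\<mu> \<nu>. metric_profile z $ \<mu> $ \<nu> = metric_profile z $ \<nu> $ \<mu>"
      by (simp add: forall_3 metric_profile_def)
    then show ?thesis by blast
  qed
  have R: "ricci (\<lambda>x. metric_profile (x $ 2)) \<mu> \<nu> x = - 2 * metric_profile z $ \<mu> $ \<nu>" for \<mu> \<nu>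
    using vacuum_einstein_imp_ricci[OF assms(3), of \<mu> \<nu>] sym inverse_profile(2)[OF assms(1)]
    by (simp add: rotating_metric_eq assms(2) matrix_inv_profile[OF assms(1)])
  note ric = R[unfolded ricci_radial sum_3 assms(2)]
  \<comment> \<open>In terms of these quotients the symbols and their derivatives are polynomial
    expressions, so the field equations can be combined linearly.\<close>
  define F where "F = f' z / f z"
  define H where "H = h' z / h z"
  define V where "V = w' z / f z"
  define Z where "Z = 1 / z"
  define F2 where "F2 = f'' z / f z"
  define V2 where "V2 = w'' z / f z"
  have subst: "f' z = F * f z" "h' z = H * h z" "w' z = V * f z" "f'' z = F2 * f z" "w'' z = V2 * f z"
    and Z: "Z \<noteq> 0"
    using nz' by (simp_all add: F_def H_def V_def F2_def V2_def Z_def)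
  have \<Gamma>s:
    "\<Gamma> 2 1 1 z = - h z / 2 * (2 * w z * V * f z - F * f z - 2 * (w z ^ 2 - f z) * Z)"
    "\<Gamma> 2 1 3 z = h z * V * f z / 2 - h z * w z * Z"
    "\<Gamma> 2 3 1 z = h z * V * f z / 2 - h z * w z * Z"
    "\<Gamma> 2 3 3 z = h z * Z"
    "\<Gamma> 2 2 2 z = - Z - H / 2"
    "\<Gamma> 1 1 2 z = F / 2 - Z - w z * V / 2"
    "\<Gamma> 1 2 1 z = F / 2 - Z - w z * V / 2"
    "\<Gamma> 1 3 2 z = V / 2"
    "\<Gamma> 1 2 3 z = V / 2"
    "\<Gamma> 3 1 2 z = (w z * F - f z * V - w z ^ 2 * V) / 2"
    "\<Gamma> 3 2 1 z = (w z * F - f z * V - w z ^ 2 * V) / 2"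
    "\<Gamma> 3 3 2 z = - Z + w z * V / 2"
    "\<Gamma> 3 2 3 z = - Z + w z * V / 2"
    "deriv (\<Gamma> 2 1 1) z = - H * h z / 2 * (2 * w z * V * f z - F * f z - 2 * (w z ^ 2 - f z) * Z)
      - h z / 2 * (2 * V ^ 2 * f z ^ 2 + 2 * w z * V2 * f z - F2 * f z - 2 * (2 * w z * V * f z - F * f z) * Z + 2 * (w z ^ 2 - f z) * Z ^ 2)"
    "deriv (\<Gamma> 2 1 3) z = H * h z * V * f z / 2 + h z * V2 * f z / 2 - H * h z * w z * Z - h z * V * f z * Z + h z * w z * Z ^ 2"
    "deriv (\<Gamma> 2 3 3) z = H * h z * Z - h z * Z ^ 2"
    "deriv (\<Gamma> 1 2 1) z = F2 / 2 - F ^ 2 / 2 + Z ^ 2 - (V ^ 2 * f z + w z * V2) / 2 + w z * V * F / 2"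
    "deriv (\<Gamma> 3 2 3) z = Z ^ 2 + (V ^ 2 * f z + w z * V2) / 2 - w z * V * F / 2"
    using nz' unfolding christoffel_profile[OF assms(1)] deriv_christoffel_profile[OF assms(1)]
    by (simp_all add: F_def H_def V_def F2_def V2_def Z_def field_simps power2_eq_square)
  have Ms: "metric_profile z $ 1 $ 1 = (w z ^ 2 - f z) * Z ^ 2" "metric_profile z $ 1 $ 3 = - w z * Z ^ 2"
    "metric_profile z $ 3 $ 3 = Z ^ 2" "metric_profile z $ 2 $ 2 = Z ^ 2 / h z"
    by (simp_all add: metric_profile_def Z_def power_divide)
  note ric = R[unfolded ricci_radial sum_3 assms(2)]
  note simps = \<Gamma>s christoffel_profile(14-)[OF assms(1)] Ms
  have e33: "H * h z * Z / 2 - 2 * h z * Z ^ 2 + F * h z * Z / 2 - h z * V ^ 2 * f z / 2 = - 2 * Z ^ 2"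
    using ric[of 3 3, simplified simps, simplified]
    by (simp add: algebra_simps add_divide_distrib diff_divide_distrib power2_eq_square)
  \<comment> \<open>The combination of the t-phi equation with \<open>w z\<close> times the phi-phi
    equation is the component along d/dt + w d/dphi and d/dphi. These directions are orthogonal, so
    the metric side vanishes.\<close>
  have e13: "(h z * f z / 2) * (V2 + V * (H / 2 - F / 2 - Z)) = 0"
    using ric[of 1 3, simplified simps, simplified] arg_cong[OF e33, of "\<lambda>y. w z * y"]
    by (simp add: algebra_simps add_divide_distrib diff_divide_distrib power2_eq_square del: mult_eq_0_iff)
  have e22: "h z * (- (F2 / 2 - F ^ 2 / 2 + Z ^ 2 - (V ^ 2 * f z + w z * V2) / 2 + w z * V * F / 2)
      - (Z ^ 2 + (V ^ 2 * f z + w z * V2) / 2 - w z * V * F / 2)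
      + (F / 2 - 2 * Z) * (- Z - H / 2)
      - (F / 2 - Z - w z * V / 2) ^ 2 - (- Z + w z * V / 2) ^ 2 
      - V * ((w z * F - f z * V - w z ^ 2 * V) / 2)) = - 2 * Z ^ 2"
    using ric[of 2 2] nz' by (simp add: simps field_simps power2_eq_square)
  \<comment> \<open>Hamiltonian constraint: the second derivatives cancel in $g^{zz} R_{zz} - g^{ab} R_{ab}$,
    where $a, b$ run over $t, \varphi$.\<close>
  have "f z * h z * (Z ^ 2 - F * Z / 2 + V ^ 2 * f z / 4) = f z * Z ^ 2"
    using ric[of 1 1, simplified simps, simplified] arg_cong[OF e13, of "\<lambda>y. w z * y"]
      arg_cong[OF e33, of "\<lambda>y. w z ^ 2 * y"] arg_cong[OF e33, of "\<lambda>y. f z * y"] arg_cong[OF e22, of "\<lambda>y. f z * y"]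
    by (simp add: algebra_simps add_divide_distrib diff_divide_distrib power2_eq_square)
  then have "h z * (Z ^ 2 - F * Z / 2 + V ^ 2 * f z / 4) = Z ^ 2"
    using nz' by (metis mult.assoc mult_left_cancel)
  then have X: "F * h z * Z = 2 * h z * Z ^ 2 + h z * V ^ 2 * f z / 2 - 2 * Z ^ 2"
    by (simp add: algebra_simps)
  have Zz: "Z * z ^ 2 = z" "Z ^ 2 * z ^ 2 = 1"
    using nz' by (simp_all add: Z_def power2_eq_square)
  have "F * h z * z = F * h z * Z * z ^ 2"
    by (simp only: mult.assoc Zz)
  also have "\<dots> = 2 * h z * (Z ^ 2 * z ^ 2) + h z * V ^ 2 * f z * z ^ 2 / 2 - 2 * (Z ^ 2 * z ^ 2)"
    unfolding X by (simp add: algebra_simps)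
  finally have "F * h z * z = 2 * h z + h z * V ^ 2 * f z * z ^ 2 / 2 - 2"
    by (simp only: Zz mult_1_right)
  from arg_cong[OF this, of "\<lambda>y. 2 * f z * y"]
  have "2 * z * h z * (F * f z) = 4 * h z * f z - 4 * f z + z ^ 2 * h z * (V * f z) ^ 2"
    by (simp add: algebra_simps power2_eq_square)
  then show "2 * z * h z * f' z = 4 * h z * f z - 4 * f z + z ^ 2 * h z * w' z ^ 2"
    by (simp add: subst(1,3))
  \<comment> \<open>By \<open>e33\<close> the mean of \<open>F\<close> and \<open>H\<close>, times
    \<open>h z * Z\<close>, equals the right-hand side of \<open>X\<close>.\<close>
  have "F * h z * Z = H * h z * Z"
    using X e33 by linarith
  then have FH: "F = H"
    using nz' Z by simp
  then show "f' z * h z = f z * h' z"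
    using nz' by (simp add: F_def H_def field_simps)
  have "V2 = V * Z"
    using e13 nz' FH by simp
  then show "z * w'' z = w' z"
    using nz' by (simp add: V_def V2_def Z_def field_simps)
qed

end

section \<open>Elementary symmetric polynomials and determinants\<close>

text \<open>Vieta's formula: expanding the product over subsets \<open>I\<close>, those factors
  indexed by \<open>I\<close> contribute their constant term and the others contribute the
  variable.\<close>

lemma coeff_prod_linear_factors:
  fixes x :: "'b \<Rightarrow> 'a::comm_ring_1"
  assumes "finite A" and "l \<le> card A"
  shows "coeff (\<Prod>i\<in>A. [:- x i, 1:]) (card A - l)
       = (- 1) ^ l * (\<Sum>I | I \<subseteq> A \<and> card I = l. \<Prod>i\<in>I. x i)"
proof -
  have "(\<Prod>i\<in>A. [:- x i, 1:]) = (\<Prod>i\<in>A. [:- x i:] + monom 1 1)"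
    by (intro prod.cong) (auto simp: monom_altdef)
  also have "\<dots> = (\<Sum>I\<in>Pow A. (\<Prod>i\<in>I. [:- x i:]) * (\<Prod>i\<in>A - I. monom 1 1))"
    using assms(1) by (rule prod_add)
  also have "\<dots> = (\<Sum>I\<in>Pow A. monom (\<Prod>i\<in>I. - x i) (card A - card I))"
  proof (rule sum.cong[OF refl])
    fix I assume I: "I \<in> Pow A"
    then have fin: "finite I"
      using assms(1) finite_subset by auto
    then have "(\<Prod>i\<in>I. [:- x i:]) = [:\<Prod>i\<in>I. - x i:]"
      by induction (auto simp: one_pCons)
    moreover have "(\<Prod>i\<in>A - I. monom 1 1) = (monom 1 (card A - card I) :: 'a poly)"
      using I fin by (simp add: monom_power card_Diff_subset)
    ultimately show "(\<Prod>i\<in>I. [:- x i:]) * (\<Prod>i\<in>A - I. monom 1 1) = monom (\<Prod>i\<in>I. - x i) (card A - card I)"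
      by (simp add: smult_monom)
  qed
  finally have "coeff (\<Prod>i\<in>A. [:- x i, 1:]) (card A - l)
      = (\<Sum>I\<in>Pow A. if card A - card I = card A - l then \<Prod>i\<in>I. - x i else 0)"
    by (simp add: coeff_sum)
  \<comment> \<open>Both cardinalities are at most \<open>card A\<close>, so the truncated
    subtractions can be cancelled.\<close>
  also have "\<dots> = (\<Sum>I\<in>Pow A. if card I = l then \<Prod>i\<in>I. - x i else 0)"
  proof (rule sum.cong[OF refl])
    fix I assume "I \<in> Pow A"
    then have "card I \<le> card A" using assms(1) by (auto intro: card_mono)
    then show "(if card A - card I = card A - l then \<Prod>i\<in>I. - x i else 0) = (if card I = l then \<Prod>i\<in>I. - x i else 0)"
      using assms(2) by auto
  qed
  also have "\<dots> = (\<Sum>I | I \<subseteq> A \<and> card I = l. \<Prod>i\<in>I. - x i)"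
    using assms(1) by (intro sum.mono_neutral_cong_right) auto
  also have "\<dots> = (\<Sum>I | I \<subseteq> A \<and> card I = l. (- 1) ^ l * (\<Prod>i\<in>I. x i))"
    by (intro sum.cong refl) (auto simp: prod_uminus)
  finally show ?thesis
    by (simp add: sum_distrib_left)
qed

text \<open>Over the complex numbers there are as many roots, with multiplicity, as the degree, so
  Vieta's formula covers all of \<open>proots p\<close>. The leading coefficient stays as a factor
  to avoid division.\<close>

lemma elem_sym_proots:
  fixes p :: "complex poly"
  assumes "l \<le> degree p"
  shows "lead_coeff p * elem_sym l (proots p) = (- 1) ^ l * coeff p (degree p - l)"
proof -
  obtain xs where xs: "mset xs = proots p" using ex_mset by blast
  have len: "length xs = degree p"
    by (metis size_mset size_proots_complex xs)
  have "p = Polynomial.smult (lead_coeff p) (\<Prod>x\<in>#mset xs. [:-x, 1:])"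
    using complex_poly_decompose_multiset[of p] xs by simp
  also have "(\<Prod>x\<in>#mset xs. [:-x, 1:]) = (\<Prod>i\<in>{..<degree p}. [:- (xs ! i), 1:])"
    by (simp add: prod_mset_prod_list prod.list_conv_set_nth len atLeast0LessThan flip: mset_map)
  finally have "coeff p (degree p - l)
      = lead_coeff p * coeff (\<Prod>i\<in>{..<degree p}. [:- (xs ! i), 1:]) (degree p - l)"
    by (metis coeff_smult)
  also have "\<dots> = lead_coeff p * ((- 1) ^ l * elem_sym_list l xs)"
    using coeff_prod_linear_factors[of "{..<degree p}" l "\<lambda>i. xs ! i"] assms
    by (simp add: elem_sym_list_def len)
  finally have "coeff p (degree p - l) = lead_coeff p * ((- 1) ^ l * elem_sym_list l xs)" .
  moreover have "(- 1 :: complex) ^ l * (- 1) ^ l = 1"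
    by (simp flip: power_mult_distrib)
  ultimately show ?thesis
    by (simp add: elem_sym_mset flip: xs)
qed

text \<open>A complex polynomial is determined by its values, so the definite description has a
  unique solution as soon as one is exhibited.\<close>

lemma pole_skip_poly_eqI:
  assumes "\<And>k. poly p k = pole_skip_det f1 f2 f3 \<Omega> T n k"
  shows "pole_skip_poly f1 f2 f3 \<Omega> T n = p"
  unfolding pole_skip_poly_def
  by (rule the_equality) (use assms in \<open>auto simp flip: poly_eq_poly_eq_iff\<close>)

lemma det_2_expand:
  "Determinant.det (Matrix.mat 2 2 f) = f (0, 0) * f (1, 1) - f (0, 1) * f (1, 0)"
    for f :: "nat \<times> nat \<Rightarrow> 'a::comm_ring_1"
proof -
  have "Determinant.det (Matrix.mat 2 2 f) = (\<Sum>j<2. Matrix.mat 2 2 f $$ (0, j) * cofactor (Matrix.mat 2 2 f) 0 j)"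
    by (rule laplace_expansion_row) auto
  also have "\<dots> = f (0, 0) * cofactor (Matrix.mat 2 2 f) 0 0 + f (0, 1) * cofactor (Matrix.mat 2 2 f) 0 1"
    by (simp add: numeral_2_eq_2)
  also have "cofactor (Matrix.mat 2 2 f) 0 0 = f (1, 1)"
    unfolding cofactor_def by (subst det_single) (auto simp: mat_delete_def)
  also have "cofactor (Matrix.mat 2 2 f) 0 1 = - f (1, 0)"
    unfolding cofactor_def by (subst det_single) (auto simp: mat_delete_def)
  finally show ?thesis by (simp add: algebra_simps)
qed

section \<open>Horizon data\<close>

lemma fps_mult_nth_2_3:
  fixes F G :: "'a::comm_ring_1 fps"
  shows "fps_nth (F * G) 2 = fps_nth F 0 * fps_nth G 2 + fps_nth F 1 * fps_nth G 1 + fps_nth F 2 * fps_nth G 0"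
    and "fps_nth (F * G) 3 = fps_nth F 0 * fps_nth G 3 + fps_nth F 1 * fps_nth G 2 + fps_nth F 2 * fps_nth G 1 + fps_nth F 3 * fps_nth G 0"
  by (simp_all add: fps_mult_nth eval_nat_numeral add_ac)

text \<open>Each differential equation holds as an identity of power series in \<open>z - 1\<close>;
  the relations are its lowest nontrivial coefficients. The last one needs one order more of the
  constraint, combined with the first three.\<close>

lemma horizon_jet_relations:
  fixes f1 f2 f3 :: "real \<Rightarrow> real"
  assumes F: "(\<lambda>h. f1 (1 + h)) has_fps_expansion F1" "(\<lambda>h. f2 (1 + h)) has_fps_expansion F2"
      "(\<lambda>h. f3 (1 + h)) has_fps_expansion F3"
    and zero: "fps_nth F1 0 = 0" "fps_nth F2 0 = 0"
    and nz: "fps_nth F1 1 \<noteq> 0" "fps_nth F2 1 \<noteq> 0"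
    and ein: "\<forall>\<^sub>F z in at_left 1. \<forall>t \<phi>.
           vacuum_einstein_at (rotating_metric f1 f2 f3) (-1) (vector [t, z, \<phi>])"
  shows "fps_nth F1 1 * fps_nth F2 2 = fps_nth F1 2 * fps_nth F2 1"
    and "2 * fps_nth F3 2 = fps_nth F3 1"
    and "2 * fps_nth F1 1 * (fps_nth F2 1 + 2) = fps_nth F2 1 * fps_nth F3 1 ^ 2"
    and "2 * fps_nth F2 2 = 5 * fps_nth F2 1 + 8"
proof -
  have dF: "(\<lambda>h. deriv f1 (1 + h)) has_fps_expansion fps_deriv F1"
    "(\<lambda>h. deriv f2 (1 + h)) has_fps_expansion fps_deriv F2"
    "(\<lambda>h. deriv f3 (1 + h)) has_fps_expansion fps_deriv F3"
    by (fact F[THEN has_fps_expansion_deriv_shift])+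
  have ddF: "(\<lambda>h. deriv (deriv f3) (1 + h)) has_fps_expansion fps_deriv (fps_deriv F3)"
    by (rule has_fps_expansion_deriv_shift[OF dF(3)])
  have "\<forall>\<^sub>F z in nhds 1. (f1 has_field_derivative deriv f1 z) (at z)"
    "\<forall>\<^sub>F z in nhds 1. (f2 has_field_derivative deriv f2 z) (at z)"
    "\<forall>\<^sub>F z in nhds 1. (f3 has_field_derivative deriv f3 z) (at z)"
    "\<forall>\<^sub>F z in nhds 1. (deriv f1 has_field_derivative deriv (deriv f1) z) (at z)"
    "\<forall>\<^sub>F z in nhds 1. (deriv f3 has_field_derivative deriv (deriv f3) z) (at z)"
    "\<forall>\<^sub>F z in nhds 1. z \<noteq> (0::real)"
    using F dF by (auto intro: eventually_differentiable_of_fps_expansion t1_space_nhds)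
  moreover have "\<forall>\<^sub>F z in nhds 1. z \<noteq> 1 \<longrightarrow> f1 z \<noteq> 0" "\<forall>\<^sub>F z in nhds 1. z \<noteq> 1 \<longrightarrow> f2 z \<noteq> 0"
    using has_fps_expansion_eventually_nonzero[OF F(1)] has_fps_expansion_eventually_nonzero[OF F(2)]
      fps_nonzero_nth[of F1] fps_nonzero_nth[of F2] nz
    by (auto simp: eventually_nhds_shift[of _ "1::real"] eventually_at_filter)
  ultimately have "\<forall>\<^sub>F z in nhds 1.
      (f1 has_field_derivative deriv f1 z) (at z) \<and> (f2 has_field_derivative deriv f2 z) (at z) \<and>
      (f3 has_field_derivative deriv f3 z) (at z) \<and> (deriv f1 has_field_derivative deriv (deriv f1) z) (at z) \<and>
      (deriv f3 has_field_derivative deriv (deriv f3) z) (at z) \<and> z \<noteq> 0 \<and>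
      (z \<noteq> 1 \<longrightarrow> f1 z \<noteq> 0) \<and> (z \<noteq> 1 \<longrightarrow> f2 z \<noteq> 0)"
    by eventually_elim blast
  then obtain S where S: "open S" "1 \<in> S" and S': "\<And>z. z \<in> S \<Longrightarrow>
      (f1 has_field_derivative deriv f1 z) (at z) \<and> (f2 has_field_derivative deriv f2 z) (at z) \<and>
      (f3 has_field_derivative deriv f3 z) (at z) \<and> (deriv f1 has_field_derivative deriv (deriv f1) z) (at z) \<and>
      (deriv f3 has_field_derivative deriv (deriv f3) z) (at z) \<and> z \<noteq> 0 \<and>
      (z \<noteq> 1 \<longrightarrow> f1 z \<noteq> 0) \<and> (z \<noteq> 1 \<longrightarrow> f2 z \<noteq> 0)"
    unfolding eventually_nhds by blast
  \<comment> \<open>The horizon itself is excluded, since the metric degenerates where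
    \<open>f1\<close> and \<open>f2\<close> vanish.\<close>
  define U where "U = S \<inter> {..<1}"
  have U: "open U" unfolding U_def using S by (intro open_Int open_lessThan)
  have "\<forall>\<^sub>F z in at_left 1. z \<in> U"
    using eventually_nhds_in_open[OF S] by (auto simp: U_def eventually_at_filter elim: eventually_mono)
  then have odes: "\<forall>\<^sub>F z in at_left 1.
      2 * z * f2 z * deriv f1 z = 4 * f2 z * f1 z - 4 * f1 z + z ^ 2 * f2 z * deriv f3 z ^ 2 \<and>
      deriv f1 z * f2 z = f1 z * deriv f2 z \<and> z * deriv (deriv f3) z = deriv f3 z"
    using ein
  proof eventually_elim
    case (elim z)
    have E: "vacuum_einstein_at (rotating_metric f1 f2 f3) (-1) (vector [0, z, 0])"
      using elim(2) by blast
    show ?case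
      by (intro conjI; rule vacuum_einstein_odes[OF U _ _ _ _ _ _ _ _ elim(1) _ E])
        (auto simp: U_def dest!: S')
  qed
  \<comment> \<open>\<open>P1\<close>, \<open>P2\<close>, \<open>P3\<close> are the differences of
    the two sides of the equations, with \<open>z\<close> written as
    \<open>1 + fps_X\<close>.\<close>
  define P1 where "P1 = 2 * (1 + fps_X) * F2 * fps_deriv F1 - (4 * F2 * F1 - 4 * F1 + (1 + fps_X) ^ 2 * F2 * fps_deriv F3 ^ 2)"
  define P2 where "P2 = fps_deriv F1 * F2 - F1 * fps_deriv F2"
  define P3 where "P3 = (1 + fps_X) * fps_deriv (fps_deriv F3) - fps_deriv F3"
  have "(\<lambda>h. 2 * (1 + h) * f2 (1 + h) * deriv f1 (1 + h) - (4 * f2 (1 + h) * f1 (1 + h) - 4 * f1 (1 + h)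
      + (1 + h) ^ 2 * f2 (1 + h) * deriv f3 (1 + h) ^ 2)) has_fps_expansion P1"
    unfolding P1_def power2_eq_square by (intro fps_expansion_intros F dF)
  then have P1: "P1 = 0"
    by (rule has_fps_expansion_eq_0_at_left) (use odes in \<open>simp add: eventually_at_left_shift[of _ 1] eventually_conj_iff\<close>)
  have "(\<lambda>h. deriv f1 (1 + h) * f2 (1 + h) - f1 (1 + h) * deriv f2 (1 + h)) has_fps_expansion P2"
    unfolding P2_def by (intro fps_expansion_intros F dF)
  then have P2: "P2 = 0"
    by (rule has_fps_expansion_eq_0_at_left) (use odes in \<open>simp add: eventually_at_left_shift[of _ 1] eventually_conj_iff\<close>)
  have "(\<lambda>h. (1 + h) * deriv (deriv f3) (1 + h) - deriv f3 (1 + h)) has_fps_expansion P3"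
    unfolding P3_def by (intro fps_expansion_intros dF ddF)
  then have P3: "P3 = 0"
    by (rule has_fps_expansion_eq_0_at_left) (use odes in \<open>simp add: eventually_at_left_shift[of _ 1] eventually_conj_iff\<close>)
  note nth = fps_numeral_nth fps_mult_nth_1 fps_mult_nth_2_3 power2_eq_square numeral_2_eq_2[symmetric] numeral_3_eq_3[symmetric]
  \<comment> \<open>Orders 0 and 1 of \<open>P2\<close> vanish identically because \<open>f1\<close>
    and \<open>f2\<close> have zeros at the horizon, so order 2 is the first to carry
    information.\<close>
  have "fps_nth P2 2 = 0" by (simp add: P2)
  then show pq: "fps_nth F1 1 * fps_nth F2 2 = fps_nth F1 2 * fps_nth F2 1"
    by (simp add: P2_def nth zero algebra_simps)
  have "fps_nth P3 0 = 0" by (simp add: P3)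
  then show g: "2 * fps_nth F3 2 = fps_nth F3 1"
    by (simp add: P3_def nth)
  have "fps_nth P1 1 = 0" by (simp add: P1)
  then show c: "2 * fps_nth F1 1 * (fps_nth F2 1 + 2) = fps_nth F2 1 * fps_nth F3 1 ^ 2"
    by (simp add: P1_def nth zero algebra_simps)
  define p1 p2 q1 q2 g1 where "p1 = fps_nth F1 1" and "p2 = fps_nth F1 2" and "q1 = fps_nth F2 1"
    and "q2 = fps_nth F2 2" and "g1 = fps_nth F3 1"
  note jets = this
  have "fps_nth P1 2 = 0" by (simp add: P1)
  then have "6 * (p1 * q2) - 2 * (q1 * p1) + 4 * p2 - 4 * (q1 * g1 ^ 2) - q2 * g1 ^ 2 = 0"
    using g pq unfolding jets
    by (simp add: P1_def nth zero algebra_simps)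
  \<comment> \<open>Multiplication by \<open>q1\<close> produces \<open>q1 * g1 ^ 2\<close> and
    \<open>p2 * q1\<close>, which \<open>c\<close> and \<open>pq\<close> replace. The common factor
    \<open>p1 * q1\<close> then splits off.\<close>
  then have "q1 * (6 * (p1 * q2) - 2 * (q1 * p1) + 4 * p2 - 4 * (q1 * g1 ^ 2) - q2 * g1 ^ 2) = 0"
    by simp
  then have "6 * p1 * q1 * q2 - 2 * q1 ^ 2 * p1 + 4 * (p2 * q1) - 4 * q1 * (q1 * g1 ^ 2) - q2 * (q1 * g1 ^ 2) = 0"
    by (simp add: algebra_simps power2_eq_square)
  then have "2 * p1 * q1 * (2 * q2 - (5 * q1 + 8)) = 0"
    unfolding c[folded jets, symmetric] pq[folded jets, symmetric]
    by (simp add: algebra_simps power2_eq_square del: mult_eq_0_iff)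
  then show "2 * fps_nth F2 2 = 5 * fps_nth F2 1 + 8"
    using nz by (simp add: jets)
qed

text \<open>The assumptions \<open>E\<close> are Vieta's formulas for the two determinants and
  \<open>r\<close> are the jet relations. Together they express every symmetric function through
  \<open>q1\<close> and \<open>E11\<close>, which are tied by
  \<open>E11 ^ 2 = - 2 * q1 - 4\<close>.\<close>

lemma pole_skip_algebra:
  fixes p1 p2 q1 q2 g1 g2 a E11 E12 E22 E23 E24 :: complex
  assumes nz: "p1 \<noteq> 0" "q1 \<noteq> 0" "a \<noteq> 0" and a: "p1 * q1 = a ^ 2"
    and r: "p1 * q2 = p2 * q1" "2 * g2 = g1" "2 * p1 * (q1 + 2) = q1 * g1 ^ 2" "2 * q2 = 5 * q1 + 8"
    and A: "A2 = p1 * q1" "A3 = p1 * q2 + p2 * q1"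
    and E: "p1 * E11 = \<i> * a * g1" "p1 * E12 = - (a ^ 2 / 2)"
      "p1 ^ 2 * E22 = - 4 * a ^ 2 * g1 ^ 2 - p1 * (A3 / 2 + A2) + a ^ 2 * (g1 ^ 2 - p2)"
      "p1 ^ 2 * E23 = - (2 * \<i> * a * g1 * (A3 / 2 + A2) + 2 * \<i> * a ^ 3 * g2)"
      "p1 ^ 2 * E24 = a ^ 2 * (A3 - A2)"
  shows "4 + E11 ^ 2 - 4 * E12 = 0
    \<and> 4 * E11 ^ 2 + 8 * E12 - E22 - 4 = 0
    \<and> 48 * E11 ^ 2 * E12 - 12 * E11 ^ 4 * E12 + 48 * E12 ^ 2
        + 12 * E11 ^ 2 * E12 ^ 2 + 16 * E12 ^ 3 - 16 * E12 * E22
        + 4 * E11 ^ 2 * E12 * E22 + 4 * E24 - 8 * E11 * E12 * E23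
        + E11 ^ 2 * E24 + 12 * E12 * E24 = 0
    \<and> 32 * E11 * E12 + 32 * E11 ^ 3 * E12 - 64 * E11 * E12 ^ 2
        - 8 * E11 * E12 * E22 + 8 * E12 * E23 = 0"
proof -
  \<comment> \<open>This is the constant ratio of \<open>f1\<close> to \<open>f2\<close>; it cancels
    from all the symmetric functions.\<close>
  define \<kappa> where "\<kappa> = p1 / q1"
  have \<kappa>: "\<kappa> \<noteq> 0" using nz by (simp add: \<kappa>_def)
  have p1: "p1 = \<kappa> * q1" using nz by (simp add: \<kappa>_def)
  have c0: "\<kappa> * q1 \<noteq> 0" "(\<kappa> * q1) ^ 2 \<noteq> 0" using \<kappa> nz(2) by simp_all
  have q2: "q2 = (5 * q1 + 8) / 2" unfolding r(4)[symmetric] by simp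
  have p2: "p2 = \<kappa> * q2" using r(1) nz by (simp add: p1)
  have a2: "a ^ 2 = \<kappa> * q1 ^ 2" using a by (simp add: p1 power2_eq_square mult.assoc)
  have g1: "g1 ^ 2 = 2 * \<kappa> * (q1 + 2)" using r(3) nz by (simp add: p1 mult.assoc)
  \<comment> \<open>The odd symmetric functions depend on the sign of \<open>a * g1\<close>, which
    the squares \<open>a2\<close> and \<open>g1\<close> do not determine. Keeping \<open>E11\<close>
    itself retains it.\<close>
  have iag: "\<i> * a * g1 = \<kappa> * q1 * E11" using E(1) by (simp add: p1)
  have "(\<kappa> * q1 * E11) ^ 2 = - (a ^ 2 * g1 ^ 2)"
    unfolding iag[symmetric] by (simp add: power_mult_distrib)
  then have "(\<kappa> * q1) ^ 2 * E11 ^ 2 = - (\<kappa> * q1 ^ 2 * (2 * \<kappa> * (q1 + 2)))"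
    unfolding a2 g1 by (simp only: power_mult_distrib)
  also have "\<dots> = (\<kappa> * q1) ^ 2 * (- 2 * q1 - 4)"
    by (simp add: power2_eq_square algebra_simps)
  finally have s: "E11 ^ 2 = - 2 * q1 - 4"
    by (rule mult_left_cancel[OF c0(2), THEN iffD1])
  have "(\<kappa> * q1) * E12 = (\<kappa> * q1) * (- q1 / 2)"
    using E(2) unfolding a2 by (simp add: p1 power2_eq_square field_simps)
  then have E12: "E12 = - q1 / 2"
    by (rule mult_left_cancel[OF c0(1), THEN iffD1])
  have "- 4 * a ^ 2 * g1 ^ 2 - p1 * (A3 / 2 + A2) + a ^ 2 * (g1 ^ 2 - p2) = (\<kappa> * q1) ^ 2 * (- 12 * q1 - 20)"
    unfolding a2 g1 A by (simp add: p1 p2 q2 power2_eq_square field_simps)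
  with E(3) have "(\<kappa> * q1) ^ 2 * E22 = (\<kappa> * q1) ^ 2 * (- 12 * q1 - 20)"
    by (simp only: p1)
  then have E22: "E22 = - 12 * q1 - 20"
    by (rule mult_left_cancel[OF c0(2), THEN iffD1])
  have "2 * \<i> * a ^ 3 * g2 = a ^ 2 * (\<i> * a * g1)"
    unfolding r(2)[symmetric] by (simp add: power3_eq_cube power2_eq_square)
  then have "p1 ^ 2 * E23 = - (2 * (\<i> * a * g1) * (A3 / 2 + A2) + a ^ 2 * (\<i> * a * g1))"
    using E(4) by (simp only: mult.assoc)
  also have "\<dots> = (\<kappa> * q1) ^ 2 * (- 8 * E11 * (q1 + 1))"
    unfolding iag a2 A by (simp add: p1 p2 q2 power2_eq_square field_simps)
  finally have "(\<kappa> * q1) ^ 2 * E23 = (\<kappa> * q1) ^ 2 * (- 8 * E11 * (q1 + 1))"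
    by (simp only: p1)
  then have E23: "E23 = - 8 * E11 * (q1 + 1)"
    by (rule mult_left_cancel[OF c0(2), THEN iffD1])
  have "a ^ 2 * (A3 - A2) = (\<kappa> * q1) ^ 2 * (q1 * (4 * q1 + 8))"
    unfolding a2 A by (simp add: p1 p2 q2 power2_eq_square field_simps)
  with E(5) have "(\<kappa> * q1) ^ 2 * E24 = (\<kappa> * q1) ^ 2 * (q1 * (4 * q1 + 8))"
    by (simp only: p1)
  then have E24: "E24 = q1 * (4 * q1 + 8)"
    by (rule mult_left_cancel[OF c0(2), THEN iffD1])
  \<comment> \<open>Eliminating \<open>q1\<close> in favour of \<open>E11\<close> turns the four
    relations into polynomial identities in one variable.\<close>
  have q1: "q1 = - (E11 ^ 2 + 4) / 2"
    unfolding s by simp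
  show ?thesis
    unfolding E12 E22 E23 E24 unfolding q1
    by (simp add: field_simps power2_eq_square power3_eq_cube power4_eq_xxxx)
qed

section \<open>The wave equation and the pole-skipping determinants\<close>

text \<open>The first two coefficients are real and are expanded over the reals. The third contains
  complex \<open>\<omega>\<close> and \<open>k\<close> and needs \<open>real_fps_expansion\<close>.
  Division by \<open>z\<close> becomes division by the unit \<open>1 + fps_X\<close>.\<close>

lemma wave_coeff_expansions:
  fixes f1 f2 f3 :: "real \<Rightarrow> real"
  assumes F: "(\<lambda>h. f1 (1 + h)) has_fps_expansion F1" "(\<lambda>h. f2 (1 + h)) has_fps_expansion F2"
      "(\<lambda>h. f3 (1 + h)) has_fps_expansion F3"
  shows "taylor_coeff (coeff_A f1 f2) (int n) = of_real (fps_nth (F1 * F2) n)"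
    and "taylor_coeff (coeff_B f1 f2) (int n)
      = of_real (fps_nth (fps_const (1 / 2) * fps_deriv (F1 * F2) - F1 * F2 / (1 + fps_X)) n)"
    and "taylor_coeff (coeff_C f1 f3 \<omega> k) (int n)
      = fps_nth ((fps_const \<omega> - fps_const k * complex_fps F3) ^ 2 - fps_const (k ^ 2) * complex_fps F1) n"
proof -
  have A: "(\<lambda>h. f1 (1 + h) * f2 (1 + h)) has_fps_expansion F1 * F2"
    by (intro fps_expansion_intros F)
  show "taylor_coeff (coeff_A f1 f2) (int n) = of_real (fps_nth (F1 * F2) n)"
    unfolding coeff_A_def by (rule taylor_coeff_of_real[OF A])
  have "(\<lambda>h. 1 / 2 * deriv (\<lambda>y. f1 y * f2 y) (1 + h) - f1 (1 + h) * f2 (1 + h) / (1 + h))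
      has_fps_expansion fps_const (1 / 2) * fps_deriv (F1 * F2) - F1 * F2 / (1 + fps_X)"
    by (intro fps_expansion_intros F has_fps_expansion_deriv_shift[of "\<lambda>y. f1 y * f2 y", OF A]) simp
  then show "taylor_coeff (coeff_B f1 f2) (int n)
      = of_real (fps_nth (fps_const (1 / 2) * fps_deriv (F1 * F2) - F1 * F2 / (1 + fps_X)) n)"
    unfolding coeff_B_def by (rule taylor_coeff_of_real)
  have cF: "real_fps_expansion (\<lambda>z. complex_of_real (f1 z)) 1 (complex_fps F1)"
    "real_fps_expansion (\<lambda>z. complex_of_real (f3 z)) 1 (complex_fps F3)"
    unfolding complex_fps_def using F by (auto intro: real_fps_expansion_of_real)
  have L: "real_fps_expansion (\<lambda>z. \<omega> + (- k) * complex_of_real (f3 z)) 1 (fps_const \<omega> + fps_const (- k) * complex_fps F3)"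
    by (intro real_fps_expansion_add real_fps_expansion_mult real_fps_expansion_const cF)
  have "real_fps_expansion (\<lambda>z. (\<omega> + (- k) * complex_of_real (f3 z)) * (\<omega> + (- k) * complex_of_real (f3 z))
        + (- (k ^ 2)) * complex_of_real (f1 z)) 1
      ((fps_const \<omega> + fps_const (- k) * complex_fps F3) * (fps_const \<omega> + fps_const (- k) * complex_fps F3)
        + fps_const (- (k ^ 2)) * complex_fps F1)"
    by (intro real_fps_expansion_add[OF real_fps_expansion_mult[OF L L]] real_fps_expansion_mult real_fps_expansion_const cF)
  from taylor_coeff_eq_fps_nth[OF this, of n]
  show "taylor_coeff (coeff_C f1 f3 \<omega> k) (int n)
      = fps_nth ((fps_const \<omega> - fps_const k * complex_fps F3) ^ 2 - fps_const (k ^ 2) * complex_fps F1) n"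
    by (simp add: coeff_C_def[abs_def] power2_eq_square flip: fps_const_neg)
qed

lemma horizon_exponent_pole_skip_freq:
  assumes "T > 0"
  shows "horizon_exponent T (pole_skip_freq T n) = - of_nat n / 2"
  using assms by (simp add: horizon_exponent_def pole_skip_freq_def field_simps)

text \<open>The coefficients of B are combinations of those of A. With the exponent
  \<open>- n / 2\<close>, the coefficient A_3 cancels for \<open>n = 1\<close> and A_4 cancels for
  \<open>n = 2\<close>. What remains involves \<open>f1\<close> and \<open>f2\<close> only to second
  order.\<close>

lemma pole_skip_dets:
  fixes f1 f2 f3 :: "real \<Rightarrow> real"
  assumes F: "(\<lambda>h. f1 (1 + h)) has_fps_expansion F1" "(\<lambda>h. f2 (1 + h)) has_fps_expansion F2"
      "(\<lambda>h. f3 (1 + h)) has_fps_expansion F3"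
    and zero: "fps_nth F1 0 = 0" "fps_nth F2 0 = 0" and \<Omega>: "\<Omega> = fps_nth F3 0" and T: "T > 0"
  defines "a \<equiv> complex_of_real (4 * pi * T)"
    and "A2 \<equiv> complex_of_real (fps_nth (F1 * F2) 2)" and "A3 \<equiv> complex_of_real (fps_nth (F1 * F2) 3)"
    and "p1 \<equiv> complex_of_real (fps_nth F1 1)" and "p2 \<equiv> complex_of_real (fps_nth F1 2)"
    and "g1 \<equiv> complex_of_real (fps_nth F3 1)" and "g2 \<equiv> complex_of_real (fps_nth F3 2)"
  shows "pole_skip_det f1 f2 f3 \<Omega> T 1 k = A2 / 2 + \<i> * a * g1 * k - p1 * k ^ 2"
    and "pole_skip_det f1 f2 f3 \<Omega> T 2 k
      = (A3 / 2 + A2 + (2 * \<i> * a * g1 * k - p1 * k ^ 2)) * (2 * \<i> * a * g1 * k - p1 * k ^ 2)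
        + a ^ 2 * (A3 - A2 + (2 * \<i> * a * g2 * k + (g1 ^ 2 - p2) * k ^ 2))"
proof -
  define A where "A = F1 * F2"
  define Q where "Q = A / (1 + fps_X)"
  have Q: "Q * (1 + fps_X) = A"
    unfolding Q_def by (simp add: fps_divide_unit mult.assoc inverse_mult_eq_1)
  have A01: "fps_nth A 0 = 0" "fps_nth A 1 = 0"
    by (simp_all add: A_def zero fps_mult_nth_1)
  \<comment> \<open>\<open>Q\<close> is the series of A divided by \<open>z\<close>; this recursion
    determines its coefficients one after the other.\<close>
  have nthQ: "fps_nth A (n + 1) = fps_nth Q (n + 1) + fps_nth Q n" for n
    unfolding Q[symmetric] by (simp add: ring_distribs)
  have Q0: "fps_nth Q 0 = 0" using A01(1) unfolding Q[symmetric] by simp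
  have Q1: "fps_nth Q 1 = 0" using nthQ[of 0] A01 Q0 by simp
  have Q2: "fps_nth Q 2 = fps_nth A 2" using nthQ[of 1] Q1 by (simp only: one_add_one add_0_right)
  have Q3: "fps_nth Q 3 = fps_nth A 3 - fps_nth A 2" using nthQ[of 2] Q2 by simp
  define B where "B = fps_const (1 / 2) * fps_deriv A - Q"
  have nthB: "fps_nth B n = real (n + 1) / 2 * fps_nth A (n + 1) - fps_nth Q n" for n
    by (simp add: B_def)
  have B: "fps_nth B 1 = fps_nth A 2" "fps_nth B 2 = 3 / 2 * fps_nth A 3 - fps_nth A 2"
    "fps_nth B 3 = 2 * fps_nth A 4 - fps_nth A 3 + fps_nth A 2"
    using Q1 by (simp_all add: nthB Q2 Q3 flip: numeral_2_eq_2)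
  have tA: "taylor_coeff (coeff_A f1 f2) (int n) = of_real (fps_nth A n)" for n
    unfolding A_def by (rule wave_coeff_expansions(1)[OF F])
  have tB: "taylor_coeff (coeff_B f1 f2) (int n) = of_real (fps_nth B n)" for n
    unfolding A_def B_def Q_def by (rule wave_coeff_expansions(2)[OF F])
  have tC: "taylor_coeff (coeff_C f1 f3 (w + k * complex_of_real \<Omega>) k) 0 = w ^ 2"
    "taylor_coeff (coeff_C f1 f3 (w + k * complex_of_real \<Omega>) k) 1 = - 2 * w * k * g1 - k ^ 2 * p1"
    "taylor_coeff (coeff_C f1 f3 (w + k * complex_of_real \<Omega>) k) 2 = - 2 * w * k * g2 + k ^ 2 * g1 ^ 2 - k ^ 2 * p2"
    for w
  proof -
    define L where "L = fps_const (w + k * complex_of_real \<Omega>) - fps_const k * complex_fps F3"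
    \<comment> \<open>The shift of the frequency by \<open>k * \<Omega>\<close> cancels the value of
      \<open>k * f3\<close> at the horizon, so the constant term is the co-rotating
      frequency.\<close>
    have L: "fps_nth L 0 = w" "fps_nth L 1 = - k * g1" "fps_nth L 2 = - k * g2"
      by (simp_all add: L_def \<Omega> g1_def g2_def)
    have tC: "taylor_coeff (coeff_C f1 f3 (w + k * complex_of_real \<Omega>) k) (int n)
        = fps_nth (L * L) n - k ^ 2 * of_real (fps_nth F1 n)" for n
      unfolding wave_coeff_expansions(3)[OF F] L_def by (simp add: power2_eq_square)
    show "taylor_coeff (coeff_C f1 f3 (w + k * complex_of_real \<Omega>) k) 0 = w ^ 2"
      using tC[of 0] by (simp add: L zero power2_eq_square)
    show "taylor_coeff (coeff_C f1 f3 (w + k * complex_of_real \<Omega>) k) 1 = - 2 * w * k * g1 - k ^ 2 * p1"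
      using tC[of 1] L by (simp add: fps_mult_nth_1 p1_def)
    show "taylor_coeff (coeff_C f1 f3 (w + k * complex_of_real \<Omega>) k) 2 = - 2 * w * k * g2 + k ^ 2 * g1 ^ 2 - k ^ 2 * p2"
      using tC[of 2] L by (simp add: fps_mult_nth_2_3 p2_def power2_eq_square)
  qed
  note t = tA[of 2, simplified] tA[of 3, simplified] tA[of 4, simplified]
    tB[of 1, simplified] tB[of 2, simplified] tB[of 3, simplified]
  have A: "of_real (fps_nth A 2) = A2" "of_real (fps_nth A 3) = A3"
    by (simp_all add: A_def A2_def A3_def)
  have w: "pole_skip_freq T 1 = - \<i> * a / 2" "pole_skip_freq T 2 = - \<i> * a"
    by (simp_all add: pole_skip_freq_def a_def)
  have entry: "pole_skip_entry f1 f2 f3 \<Omega> T (pole_skip_freq T n) k K S =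
      taylor_coeff (coeff_A f1 f2) (int K - int S + 3) * (- of_nat n / 2 + of_nat S - 1) * (- of_nat n / 2 + of_nat S - 2)
      + taylor_coeff (coeff_B f1 f2) (int K - int S + 2) * (- of_nat n / 2 + of_nat S - 1)
      + taylor_coeff (coeff_C f1 f3 (pole_skip_freq T n + k * complex_of_real \<Omega>) k) (int K - int S + 1)" for n K S
    by (simp only: pole_skip_entry_def Let_def horizon_exponent_pole_skip_freq[OF T])
  have "pole_skip_entry f1 f2 f3 \<Omega> T (pole_skip_freq T 1) k 1 1 = A2 / 2 + \<i> * a * g1 * k - p1 * k ^ 2"
    unfolding entry by (simp add: t tC B[simplified], simp add: A w[simplified] field_simps)
  then show "pole_skip_det f1 f2 f3 \<Omega> T 1 k = A2 / 2 + \<i> * a * g1 * k - p1 * k ^ 2"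
    unfolding pole_skip_det_def by (subst det_single) simp_all
  have idx: "int 1 - int 1 + 3 = 3" "int 1 - int 1 + 2 = 2" "int 1 - int 1 + 1 = 1"
    "int 1 - int 2 + 3 = 2" "int 1 - int 2 + 2 = 1" "int 1 - int 2 + 1 = 0"
    "int 2 - int 1 + 3 = 4" "int 2 - int 1 + 2 = 3" "int 2 - int 1 + 1 = 2"
    "int 2 - int 2 + 3 = 3" "int 2 - int 2 + 2 = 2" "int 2 - int 2 + 1 = 1"
    by simp_all
  \<comment> \<open>In the second column the factor \<open>\<rho> + S - 1\<close> is zero, so only C
    contributes. In the lower left entry A_4 enters as \<open>2 * A_4\<close> from A and as
    \<open>- 2 * A_4\<close> from B.\<close>
  have M: "pole_skip_entry f1 f2 f3 \<Omega> T (pole_skip_freq T 2) k 1 1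
        = A3 / 2 + A2 + (2 * \<i> * a * g1 * k - p1 * k ^ 2)"
      "pole_skip_entry f1 f2 f3 \<Omega> T (pole_skip_freq T 2) k 1 2 = - (a ^ 2)"
      "pole_skip_entry f1 f2 f3 \<Omega> T (pole_skip_freq T 2) k 2 1
        = A3 - A2 + (2 * \<i> * a * g2 * k + (g1 ^ 2 - p2) * k ^ 2)"
      "pole_skip_entry f1 f2 f3 \<Omega> T (pole_skip_freq T 2) k 2 2 = 2 * \<i> * a * g1 * k - p1 * k ^ 2"
    unfolding entry unfolding idx t tC B unfolding w of_real_diff of_real_add of_real_mult A
    by (simp_all add: A power_mult_distrib algebra_simps)
  then show "pole_skip_det f1 f2 f3 \<Omega> T 2 k
      = (A3 / 2 + A2 + (2 * \<i> * a * g1 * k - p1 * k ^ 2)) * (2 * \<i> * a * g1 * k - p1 * k ^ 2)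
        + a ^ 2 * (A3 - A2 + (2 * \<i> * a * g2 * k + (g1 ^ 2 - p2) * k ^ 2))"
    unfolding pole_skip_det_def det_2_expand by (simp only: prod.case add_0 one_add_one M) simp
qed

theorem mainTheorem6:
  fixes f1 f2 f3 :: "real \<Rightarrow> real" and \<Omega>\<^sub>H T :: real and E :: "nat \<Rightarrow> nat \<Rightarrow> complex"
  assumes "real_analytic_at f1 1" and "real_analytic_at f2 1" and "real_analytic_at f3 1"
    and "f1 1 = 0" and "f2 1 = 0" and "f3 1 = \<Omega>\<^sub>H"
    and "T > 0" and "deriv f1 1 * deriv f2 1 = (4 * pi * T) ^ 2"
    and "\<forall>\<^sub>F z in at_left 1. \<forall>t \<phi>.
           vacuum_einstein_at (rotating_metric f1 f2 f3) (-1) (vector [t, z, \<phi>])"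
  defines "E \<equiv> pole_skip_E f1 f2 f3 \<Omega>\<^sub>H T"
  shows "4 + E 1 1 ^ 2 - 4 * E 1 2 = 0
    \<and> 4 * E 1 1 ^ 2 + 8 * E 1 2 - E 2 2 - 4 = 0
    \<and> 48 * E 1 1 ^ 2 * E 1 2 - 12 * E 1 1 ^ 4 * E 1 2 + 48 * E 1 2 ^ 2
        + 12 * E 1 1 ^ 2 * E 1 2 ^ 2 + 16 * E 1 2 ^ 3 - 16 * E 1 2 * E 2 2
        + 4 * E 1 1 ^ 2 * E 1 2 * E 2 2 + 4 * E 2 4 - 8 * E 1 1 * E 1 2 * E 2 3
        + E 1 1 ^ 2 * E 2 4 + 12 * E 1 2 * E 2 4 = 0
    \<and> 32 * E 1 1 * E 1 2 + 32 * E 1 1 ^ 3 * E 1 2 - 64 * E 1 1 * E 1 2 ^ 2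
        - 8 * E 1 1 * E 1 2 * E 2 2 + 8 * E 1 2 * E 2 3 = 0"
proof -
  obtain F1 F2 F3 where F: "(\<lambda>h. f1 (1 + h)) has_fps_expansion F1" "(\<lambda>h. f2 (1 + h)) has_fps_expansion F2"
      "(\<lambda>h. f3 (1 + h)) has_fps_expansion F3"
    using assms(1-3) unfolding real_analytic_at_def by blast
  have nth0: "fps_nth F1 0 = f1 1" "fps_nth F2 0 = f2 1" "fps_nth F3 0 = f3 1"
    using F[THEN has_fps_expansion_nth_0] by simp_all
  have nth1: "fps_nth F1 1 = deriv f1 1" "fps_nth F2 1 = deriv f2 1"
    using F(1,2)[THEN has_fps_expansion_deriv_shift, THEN has_fps_expansion_nth_0] by simp_all
  have zero: "fps_nth F1 0 = 0" "fps_nth F2 0 = 0" and \<Omega>: "\<Omega>\<^sub>H = fps_nth F3 0"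
    using nth0 assms(4-6) by simp_all
  have a: "fps_nth F1 1 * fps_nth F2 1 = (4 * pi * T) ^ 2"
    unfolding nth1 by (fact assms(8))
  then have nz: "fps_nth F1 1 \<noteq> 0" "fps_nth F2 1 \<noteq> 0"
    using \<open>T > 0\<close> by auto
  note jets = horizon_jet_relations[OF F zero nz assms(9)]
  define a where "a = complex_of_real (4 * pi * T)"
  define A2 A3 p1 p2 g1 g2 where "A2 = complex_of_real (fps_nth (F1 * F2) 2)" and "A3 = complex_of_real (fps_nth (F1 * F2) 3)"
    and "p1 = complex_of_real (fps_nth F1 1)" and "p2 = complex_of_real (fps_nth F1 2)"
    and "g1 = complex_of_real (fps_nth F3 1)" and "g2 = complex_of_real (fps_nth F3 2)"
  note defs = this
  define q1 q2 where "q1 = complex_of_real (fps_nth F2 1)" and "q2 = complex_of_real (fps_nth F2 2)"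
  note dets = pole_skip_dets[OF F zero \<Omega> \<open>T > 0\<close>, folded defs a_def]
  \<comment> \<open>\<open>P\<close> and \<open>R\<close> are the determinants for
    \<open>n = 1\<close> and \<open>n = 2\<close> sorted by powers of \<open>k\<close>, constant
    term first. Their leading coefficients \<open>- p1\<close> and \<open>p1 ^ 2\<close> are
    nonzero, which fixes the degrees 2 and 4.\<close>
  define P where "P = [:A2 / 2, \<i> * a * g1, - p1:]"
  define R where "R = [:a ^ 2 * (A3 - A2), 2 * \<i> * a * g1 * (A3 / 2 + A2) + 2 * \<i> * a ^ 3 * g2,
    - 4 * a ^ 2 * g1 ^ 2 - p1 * (A3 / 2 + A2) + a ^ 2 * (g1 ^ 2 - p2), - 4 * \<i> * a * g1 * p1, p1 ^ 2:]"
  have P: "pole_skip_poly f1 f2 f3 \<Omega>\<^sub>H T 1 = P"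
    by (rule pole_skip_poly_eqI, unfold dets) (simp add: P_def algebra_simps power2_eq_square)
  have R: "pole_skip_poly f1 f2 f3 \<Omega>\<^sub>H T 2 = R"
    by (rule pole_skip_poly_eqI, unfold dets) (simp add: R_def algebra_simps power2_eq_square power3_eq_cube)
  have p1: "p1 \<noteq> 0" using nz by (simp add: defs)
  have degP: "degree P = 2" and degR: "degree R = 4"
    using p1 by (simp_all add: P_def R_def)
  have EP: "- p1 * E 1 l = (- 1) ^ l * coeff P (2 - l)" if "l \<le> 2" for l
    using elem_sym_proots[of l P] that unfolding E_def pole_skip_E_def P degP
    by (simp add: P_def eval_nat_numeral)
  have ER: "p1 ^ 2 * E 2 l = (- 1) ^ l * coeff R (4 - l)" if "l \<le> 4" for l
    using elem_sym_proots[of l R] that unfolding E_def pole_skip_E_def R degR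
    by (simp add: R_def eval_nat_numeral)
  show ?thesis
  proof (rule pole_skip_algebra)
    show "p1 \<noteq> 0" by (fact p1)
    show "q1 \<noteq> 0" using nz by (simp add: q1_def)
    show "p1 * q1 = a ^ 2"
      using a by (simp add: defs q1_def a_def flip: of_real_mult of_real_power)
    show "a \<noteq> 0" using \<open>T > 0\<close> by (simp add: a_def)
    show "p1 * q2 = p2 * q1" "2 * g2 = g1" "2 * p1 * (q1 + 2) = q1 * g1 ^ 2" "2 * q2 = 5 * q1 + 8"
      using jets[THEN arg_cong[where f = complex_of_real]] by (simp_all add: defs q1_def q2_def)
    show "A2 = p1 * q1" "A3 = p1 * q2 + p2 * q1"
      by (simp_all add: defs q1_def q2_def fps_mult_nth_2_3 zero)
    show "p1 * E 1 1 = \<i> * a * g1"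
      using EP[of 1] by (simp add: P_def)
    \<comment> \<open>The constant coefficient of \<open>P\<close> is \<open>A2 / 2\<close>, and
      \<open>A2 = p1 * q1 = a ^ 2\<close> by the temperature condition.\<close>
    have E12: "- p1 * E 1 2 = a ^ 2 / 2"
      using EP[of 2] \<open>A2 = p1 * q1\<close> \<open>p1 * q1 = a ^ 2\<close> by (simp add: P_def)
    show "p1 * E 1 2 = - (a ^ 2 / 2)"
      unfolding E12[symmetric] by simp
    show "p1 ^ 2 * E 2 2 = - 4 * a ^ 2 * g1 ^ 2 - p1 * (A3 / 2 + A2) + a ^ 2 * (g1 ^ 2 - p2)"
      "p1 ^ 2 * E 2 3 = - (2 * \<i> * a * g1 * (A3 / 2 + A2) + 2 * \<i> * a ^ 3 * g2)"
      "p1 ^ 2 * E 2 4 = a ^ 2 * (A3 - A2)"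
      using ER[of 2] ER[of 3] ER[of 4] by (simp_all add: R_def eval_nat_numeral)
  qed
qed

end
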